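(* Let $\ell\ge 2$ and $m\ge 0$ be fixed integers. Then, as $n\to\infty$, $$s^*(n,\ell,m)=\left(1+O\left(\frac{1}{\sqrt n}\right)\right)\left[\frac{1}{m!}\left(\frac{n}{\binom{\ell}{2}}\right)^m\right]^{\binom{\ell}{2}}2^n,$$ where the constant implicit in $O(\cdot)$ may depend on $\ell$ and $m$ only.
   Context: $[n]=\{1,\dots,n\}$ and $2^{[n]}$ is the set of all subsets of $[n]$. Families $\mathcal{F}_1,\dots,\mathcal{F}_\ell\subset 2^{[n]}$ satisfy the $m$-overlapping property if for any distinct $k_1,k_2\in[\ell]$ and any $F_1\in\mathcal{F}_{k_1}$, $F_2\in\mathcal{F}_{k_2}$ one has $|F_1\cap F_2|\le m$. The number $s^*(n,\ell,m)$ is the maximum of $|\mathcal{F}_1|\cdots|\mathcal{F}_\ell|$ over all families $\mathcal{F}_1,\dots,\mathcal{F}_\ell\subset 2^{[n]}$ with the $m$-overlapping property. *)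

theory Defs
  imports Complex_Main "HOL-Library.FuncSet" "HOL-Library.Landau_Symbols"
begin

definition overlapping :: "nat \<Rightarrow> nat \<Rightarrow> (nat \<Rightarrow> nat set set) \<Rightarrow> bool" where
  "overlapping m l \<F> \<longleftrightarrow>
     (\<forall>k\<^sub>1\<in>{1..l}. \<forall>k\<^sub>2\<in>{1..l}. k\<^sub>1 \<noteq> k\<^sub>2 \<longrightarrow>
        (\<forall>F\<^sub>1\<in>\<F> k\<^sub>1. \<forall>F\<^sub>2\<in>\<F> k\<^sub>2. card (F\<^sub>1 \<inter> F\<^sub>2) \<le> m))"

definition products :: "nat \<Rightarrow> nat \<Rightarrow> nat \<Rightarrow> nat set" where
  "products n l m =
     {\<Prod>k=1..l. card (\<F> k) | \<F>. \<F> \<in> {1..l} \<rightarrow> Pow (Pow {1..n}) \<and> overlapping m l \<F>}"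

definition s_star :: "nat \<Rightarrow> nat \<Rightarrow> nat \<Rightarrow> nat" where
  "s_star n l m = Max (products n l m)"

text \<open>The maximum is genuinely attained: \<^const>\<open>Max\<close> is applied to a finite nonempty set.\<close>

lemma finite_products: "finite (products n l m)"
proof (rule finite_subset)
  show "products n l m \<subseteq> {..(2 ^ n) ^ l}"
  proof
    fix p assume "p \<in> products n l m"
    then obtain \<F> where p: "p = (\<Prod>k=1..l. card (\<F> k))"
      and F: "\<F> \<in> {1..l} \<rightarrow> Pow (Pow {1..n})"
      unfolding products_def mem_Collect_eq by (elim exE conjE)
    have "card (\<F> k) \<le> 2 ^ n" if "k \<in> {1..l}" for k
    proof -
      have "\<F> k \<subseteq> Pow {1..n}" using funcset_mem[OF F that] by (rule PowD)
      then have "card (\<F> k) \<le> card (Pow {1..n})" by (intro card_mono) auto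
      then show ?thesis by (simp add: card_Pow)
    qed
    then have "p \<le> (\<Prod>k=1..l. 2 ^ n)" unfolding p by (intro prod_mono conjI le0)
    then show "p \<in> {..(2 ^ n) ^ l}" by (simp only: prod_constant card_atLeastAtMost atMost_iff diff_Suc_Suc minus_nat.diff_0 One_nat_def)
  qed
qed simp

lemma products_nonempty: "products n l m \<noteq> {}"
proof -
  have "overlapping m l (\<lambda>_. {})" by (simp add: overlapping_def)
  moreover have "(\<lambda>_. {}) \<in> {1..l} \<rightarrow> Pow (Pow {1..n})" by simp
  ultimately have "(\<Prod>k=1..l. card ((\<lambda>_. {}) k :: nat set set)) \<in> products n l m"
    unfolding products_def mem_Collect_eq by (intro exI conjI) (rule refl)
  then show ?thesis by (metis empty_iff)
qed

end

theory Submission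
  imports Defs "HOL-Analysis.Convex"
begin

text \<open>
  Daykin's inequality \<open>|A| |B| \<le> |A \<or> B| |A \<and> B|\<close>, applied repeatedly, bounds the product of the
  sizes by \<open>2^n\<close> times the sizes of the families of sets \<open>(F\<^sub>1 \<union> \<dots> \<union> F\<^sub>k\<^sub>-\<^sub>1) \<inter> F\<^sub>k\<close>. Since each of
  these sets is a union of \<open>k - 1\<close> sets of size at most \<open>m\<close>, this has the right order
  \<open>N = 2^n n^(m M)\<close>, where \<open>M\<close> is the number of pairs, but not the right constant.

  Let \<open>p\<^sub>k(x)\<close> be the proportion of members of the \<open>k\<close>-th family that contain \<open>x\<close>, and suppose that
  the product is of order \<open>N\<close>. Passing to links at \<open>x\<close> in the families of an index set \<open>S\<close> lowers
  the allowed overlap by one for each pair in \<open>S\<close>, so the crude bound gives that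
  \<open>\<Prod>k\<in>S. p\<^sub>k(x)\<close> is \<open>O(n^(-|S|(|S|-1)/2))\<close>. If all \<open>p\<^sub>k(x)\<close> are at most \<open>1/3\<close>, then \<open>|S| = 2\<close> shows
  that deleting \<open>x\<close> costs a factor well below 2, and one inducts on \<open>n\<close>. Otherwise the largest
  \<open>p\<^sub>k(x)\<close> is bounded below, and \<open>|S| = 3\<close> shows that all but the two largest are \<open>O(n^(-3/2))\<close>.
  Removing, for all \<open>x\<close>, the corresponding members loses only a proportion \<open>O(n^(-1/2))\<close>. Afterwards
  each \<open>x\<close> belongs to the supports of only two families, so the pairwise intersections live on the
  parts of a partition of the ground set into \<open>M\<close> parts, and Daykin's inequality together with AM-GM
  gives the sharp constant. Equal parts yield the lower bound.
\<close>

section \<open>Daykin's inequality\<close>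

definition joins :: "'a set set \<Rightarrow> 'a set set \<Rightarrow> 'a set set" where
  "joins \<A> \<B> = (\<lambda>(A, B). A \<union> B) ` (\<A> \<times> \<B>)"

definition meets :: "'a set set \<Rightarrow> 'a set set \<Rightarrow> 'a set set" where
  "meets \<A> \<B> = (\<lambda>(A, B). A \<inter> B) ` (\<A> \<times> \<B>)"

definition deletion :: "'a \<Rightarrow> 'a set set \<Rightarrow> 'a set set" where
  "deletion x \<A> = {A \<in> \<A>. x \<notin> A}"

definition link :: "'a \<Rightarrow> 'a set set \<Rightarrow> 'a set set" where
  "link x \<A> = {A. x \<notin> A \<and> insert x A \<in> \<A>}"

lemma joinsI: "A \<in> \<A> \<Longrightarrow> B \<in> \<B> \<Longrightarrow> A \<union> B \<in> joins \<A> \<B>"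
  by (force simp: joins_def)

lemma meetsI: "A \<in> \<A> \<Longrightarrow> B \<in> \<B> \<Longrightarrow> A \<inter> B \<in> meets \<A> \<B>"
  by (force simp: meets_def)

lemma joins_subset_Pow: "\<A> \<subseteq> Pow X \<Longrightarrow> \<B> \<subseteq> Pow X \<Longrightarrow> joins \<A> \<B> \<subseteq> Pow X"
  by (fastforce simp: joins_def)

lemma meets_subset_Pow: "\<A> \<subseteq> Pow X \<Longrightarrow> meets \<A> \<B> \<subseteq> Pow X"
  by (fastforce simp: meets_def)

lemma bij_betw_link: "bij_betw (insert x) (link x \<A>) {A \<in> \<A>. x \<in> A}"
proof (rule bij_betw_byWitness[where f' = "\<lambda>A. A - {x}"])
  show "(\<lambda>A. A - {x}) ` {A \<in> \<A>. x \<in> A} \<subseteq> link x \<A>"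
    by (auto simp: link_def insert_absorb)
qed (auto simp: link_def)

lemma card_link: "card (link x \<A>) = card {A \<in> \<A>. x \<in> A}"
  by (rule bij_betw_same_card[OF bij_betw_link])

lemma finite_link: "finite \<A> \<Longrightarrow> finite (link x \<A>)"
  by (simp add: bij_betw_finite[OF bij_betw_link])

lemma card_deletion_link:
  assumes "finite \<A>"
  shows "card \<A> = card (deletion x \<A>) + card (link x \<A>)"
proof -
  have "\<A> = deletion x \<A> \<union> {A \<in> \<A>. x \<in> A}" by (auto simp: deletion_def)
  also have "card \<dots> = card (deletion x \<A>) + card {A \<in> \<A>. x \<in> A}"
    using assms by (intro card_Un_disjoint) (auto simp: deletion_def)
  finally show ?thesis by (simp add: card_link)
qed

text \<open>One-point case of the four functions inequality. The outer products compare directly.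
  For the mixed ones, \<open>p\<close> and \<open>q\<close> are at most \<open>u\<close> and
  \<open>p * q <= u * v\<close>, so expanding \<open>(u - p) * (u - q) >= 0\<close> gives
  \<open>p + q <= u + v\<close>.\<close>

lemma four_numbers:
  fixes a\<^sub>0 a\<^sub>1 b\<^sub>0 b\<^sub>1 c\<^sub>0 c\<^sub>1 d\<^sub>0 d\<^sub>1 :: real
  assumes nonneg: "0 \<le> a\<^sub>0" "0 \<le> a\<^sub>1" "0 \<le> b\<^sub>0" "0 \<le> b\<^sub>1" "0 \<le> c\<^sub>0" "0 \<le> c\<^sub>1" "0 \<le> d\<^sub>0" "0 \<le> d\<^sub>1"
    and le: "a\<^sub>0 * b\<^sub>0 \<le> c\<^sub>0 * d\<^sub>0" "a\<^sub>0 * b\<^sub>1 \<le> c\<^sub>1 * d\<^sub>0" "a\<^sub>1 * b\<^sub>0 \<le> c\<^sub>1 * d\<^sub>0" "a\<^sub>1 * b\<^sub>1 \<le> c\<^sub>1 * d\<^sub>1"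
  shows "(a\<^sub>0 + a\<^sub>1) * (b\<^sub>0 + b\<^sub>1) \<le> (c\<^sub>0 + c\<^sub>1) * (d\<^sub>0 + d\<^sub>1)"
proof -
  define p q u v where "p = a\<^sub>0 * b\<^sub>1" and "q = a\<^sub>1 * b\<^sub>0" and "u = c\<^sub>1 * d\<^sub>0" and "v = c\<^sub>0 * d\<^sub>1"
  have nn: "0 \<le> p" "0 \<le> q" "0 \<le> u" "0 \<le> v"
    using nonneg by (simp_all add: p_def q_def u_def v_def)
  have pu: "p \<le> u" and qu: "q \<le> u"
    using le by (simp_all add: p_def q_def u_def)
  have "p * q = (a\<^sub>0 * b\<^sub>0) * (a\<^sub>1 * b\<^sub>1)" by (simp add: p_def q_def)
  also have "\<dots> \<le> (c\<^sub>0 * d\<^sub>0) * (c\<^sub>1 * d\<^sub>1)"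
    by (intro mult_mono le mult_nonneg_nonneg nonneg)
  finally have pq: "p * q \<le> u * v" by (simp add: u_def v_def mult_ac)
  have "p + q \<le> u + v"
  proof (cases "u = 0")
    case True
    then show ?thesis using pu qu nn by simp
  next
    case False
    have "0 \<le> (u - p) * (u - q)" using pu qu by simp
    then have "u * (p + q) \<le> u * (u + v)" using pq by (simp add: algebra_simps)
    then show ?thesis using False nn(3) by simp
  qed
  then show ?thesis using le by (simp add: p_def q_def u_def v_def algebra_simps)
qed

text \<open>Induction on the ground set, splitting each family at \<open>x\<close> into
  \<open>deletion\<close> and \<open>link\<close>. A union contains \<open>x\<close> if one of the
  two sets does, an intersection only if both do; so both mixed cases land in
  \<open>link x C\<close> and \<open>deletion x D\<close>, as \<open>four_numbers\<close>
  expects.\<close>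

theorem card_mult_le_joins_meets:
  assumes "finite X" "\<A> \<subseteq> Pow X" "\<B> \<subseteq> Pow X"
  shows "card \<A> * card \<B> \<le> card (joins \<A> \<B>) * card (meets \<A> \<B>)"
  using assms
proof (induction X arbitrary: \<A> \<B> rule: finite_induct)
  case empty
  then have "\<A> = {} \<or> \<A> = {{}}" "\<B> = {} \<or> \<B> = {{}}" by auto
  then show ?case by (auto simp: joins_def meets_def)
next
  case (insert x X)
  define C D where "C = joins \<A> \<B>" and "D = meets \<A> \<B>"
  have fin: "finite \<A>" "finite \<B>" "finite C" "finite D"
    using insert.prems insert.hyps
      joins_subset_Pow[OF insert.prems] meets_subset_Pow[OF insert.prems(1), of \<B>]
    by (auto simp: C_def D_def intro: finite_subset[of _ "Pow (insert x X)"])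
  \<comment> \<open>The induction hypothesis with larger target families: the links and deletions of
    \<open>C\<close> and \<open>D\<close> contain the joins and meets concerned but need not equal
    them.\<close>
  have step: "card \<A>' * card \<B>' \<le> card C' * card D'"
    if sub: "\<A>' \<subseteq> Pow X" "\<B>' \<subseteq> Pow X"
      and fin': "finite C'" "finite D'"
      and C': "\<And>A B. A \<in> \<A>' \<Longrightarrow> B \<in> \<B>' \<Longrightarrow> A \<union> B \<in> C'"
      and D': "\<And>A B. A \<in> \<A>' \<Longrightarrow> B \<in> \<B>' \<Longrightarrow> A \<inter> B \<in> D'"
    for \<A>' \<B>' C' D'
  proof -
    have "card \<A>' * card \<B>' \<le> card (joins \<A>' \<B>') * card (meets \<A>' \<B>')"
      by (rule insert.IH[OF sub])
    also have "\<dots> \<le> card C' * card D'"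
      using fin' C' D' by (intro mult_mono card_mono) (auto simp: joins_def meets_def)
    finally show ?thesis .
  qed
  have del: "deletion x \<A> \<subseteq> Pow X" "deletion x \<B> \<subseteq> Pow X"
    and lnk: "link x \<A> \<subseteq> Pow X" "link x \<B> \<subseteq> Pow X"
    using insert.prems by (auto simp: deletion_def link_def)
  have fin': "finite (deletion x C)" "finite (deletion x D)" "finite (link x C)" "finite (link x D)"
    using fin by (auto simp: deletion_def intro: finite_link)
  have CI: "A \<union> B \<in> C" and DI: "A \<inter> B \<in> D" if "A \<in> \<A>" "B \<in> \<B>" for A B
    using that by (auto simp: C_def D_def intro: joinsI meetsI)
  have 00: "card (deletion x \<A>) * card (deletion x \<B>) \<le> card (deletion x C) * card (deletion x D)"
    by (rule step[OF del fin'(1,2)]) (auto simp: deletion_def intro: CI DI)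
  have 01: "card (deletion x \<A>) * card (link x \<B>) \<le> card (link x C) * card (deletion x D)"
  proof (rule step[OF del(1) lnk(2) fin'(3,2)])
    fix A B assume AB: "A \<in> deletion x \<A>" "B \<in> link x \<B>"
    then have "A \<union> insert x B \<in> C" "A \<inter> insert x B \<in> D"
      by (intro CI DI; simp add: deletion_def link_def)+
    then show "A \<union> B \<in> link x C" "A \<inter> B \<in> deletion x D"
      using AB by (auto simp: deletion_def link_def)
  qed
  have 10: "card (link x \<A>) * card (deletion x \<B>) \<le> card (link x C) * card (deletion x D)"
  proof (rule step[OF lnk(1) del(2) fin'(3,2)])
    fix A B assume AB: "A \<in> link x \<A>" "B \<in> deletion x \<B>"
    then have "insert x A \<union> B \<in> C" "insert x A \<inter> B \<in> D"
      by (intro CI DI; simp add: deletion_def link_def)+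
    then show "A \<union> B \<in> link x C" "A \<inter> B \<in> deletion x D"
      using AB by (auto simp: deletion_def link_def)
  qed
  have 11: "card (link x \<A>) * card (link x \<B>) \<le> card (link x C) * card (link x D)"
  proof (rule step[OF lnk fin'(3,4)])
    fix A B assume AB: "A \<in> link x \<A>" "B \<in> link x \<B>"
    then have "insert x A \<union> insert x B \<in> C" "insert x A \<inter> insert x B \<in> D"
      by (intro CI DI; simp add: link_def)+
    then show "A \<union> B \<in> link x C" "A \<inter> B \<in> link x D"
      using AB by (auto simp: link_def)
  qed
  have "real (card \<A> * card \<B>) \<le> real (card C * card D)"
    unfolding fin[THEN card_deletion_link[of _ x]] of_nat_mult of_nat_add
    by (rule four_numbers) (use 00 01 10 11 in \<open>simp_all flip: of_nat_mult\<close>)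
  then show ?case unfolding C_def D_def of_nat_le_iff .
qed

section \<open>Iterating Daykin's inequality over several families\<close>

primrec iterated_joins :: "(nat \<Rightarrow> 'a set set) \<Rightarrow> nat \<Rightarrow> 'a set set" where
  "iterated_joins F 0 = {{}}"
| "iterated_joins F (Suc k) = joins (iterated_joins F k) (F k)"

lemma iterated_joins_subset_Pow:
  assumes "\<And>k. k < l \<Longrightarrow> F k \<subseteq> Pow X"
  shows "iterated_joins F l \<subseteq> Pow X"
  using assms by (induction l) (simp_all add: joins_subset_Pow)

lemma iterated_joinsE:
  assumes "S \<in> iterated_joins F l"
  obtains A where "\<And>i. i < l \<Longrightarrow> A i \<in> F i" "S = (\<Union>i<l. A i)"
proof -
  have "\<exists>A. (\<forall>i<l. A i \<in> F i) \<and> S = (\<Union>i<l. A i)"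
    using assms
  proof (induction l arbitrary: S)
    case 0
    then show ?case by simp
  next
    case (Suc l)
    then obtain S' B where S': "S' \<in> iterated_joins F l" and B: "B \<in> F l" and S: "S = S' \<union> B"
      by (auto simp: joins_def)
    from Suc.IH[OF S'] obtain A where A: "\<forall>i<l. A i \<in> F i" "S' = (\<Union>i<l. A i)" by blast
    have "\<forall>i<Suc l. (A(l := B)) i \<in> F i" using A B by (auto simp: less_Suc_eq)
    moreover have "S = (\<Union>i<Suc l. (A(l := B)) i)"
      using A S by (auto simp: lessThan_Suc)
    ultimately show ?case by blast
  qed
  then show thesis using that by blast
qed

text \<open>Each use of Daykin's inequality absorbs one more family into the join at the price of
  one family of meets. The last join is a family of subsets of \<open>X\<close>, whence the power of
  2.\<close>

lemma prod_card_le_iterated_meets: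
  assumes "finite X" "\<And>k. k < l \<Longrightarrow> F k \<subseteq> Pow X"
  shows "(\<Prod>k<l. card (F k)) \<le> 2 ^ card X * (\<Prod>k<l. card (meets (iterated_joins F k) (F k)))"
proof -
  have "(\<Prod>k<l. card (F k)) \<le> card (iterated_joins F l) * (\<Prod>k<l. card (meets (iterated_joins F k) (F k)))"
    using assms(2)
  proof (induction l)
    case 0
    then show ?case by simp
  next
    case (Suc l)
    let ?h = "\<lambda>k. card (meets (iterated_joins F k) (F k))"
    have "(\<Prod>k<Suc l. card (F k)) \<le> (card (iterated_joins F l) * (\<Prod>k<l. ?h k)) * card (F l)"
      using Suc by simp
    also have "\<dots> = (card (iterated_joins F l) * card (F l)) * (\<Prod>k<l. ?h k)" by simp
    also have "\<dots> \<le> (card (joins (iterated_joins F l) (F l)) * ?h l) * (\<Prod>k<l. ?h k)"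
      using assms(1) Suc.prems
      by (intro mult_right_mono card_mult_le_joins_meets[of X] iterated_joins_subset_Pow) auto
    finally show ?case by (simp add: mult_ac)
  qed
  also have "card (iterated_joins F l) \<le> card (Pow X)"
    using assms by (intro card_mono iterated_joins_subset_Pow) auto
  finally show ?thesis using assms(1) by (simp add: card_Pow)
qed

section \<open>Counting families through their intersections\<close>

text \<open>Unordered pairs, coded increasingly: the larger index is the family that gets met with
  the join of the earlier ones.\<close>

definition ordered_pairs :: "nat set \<Rightarrow> (nat \<times> nat) set" where
  "ordered_pairs S = {(i, j) \<in> S \<times> S. i < j}"

lemma finite_ordered_pairs: "finite S \<Longrightarrow> finite (ordered_pairs S)"
  by (rule finite_subset[of _ "S \<times> S"]) (auto simp: ordered_pairs_def)

lemma card_ordered_pairs: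
  assumes "finite S"
  shows "card (ordered_pairs S) = card S choose 2"
  using assms
proof (induction S rule: finite_linorder_max_induct)
  case empty
  then show ?case by (simp add: ordered_pairs_def)
next
  case (insert b A)
  have "ordered_pairs (insert b A) = ordered_pairs A \<union> A \<times> {b}"
    using insert.hyps by (auto simp: ordered_pairs_def)
  also have "card \<dots> = card (ordered_pairs A) + card (A \<times> {b})"
    using insert.hyps finite_ordered_pairs[of A]
    by (intro card_Un_disjoint) (auto simp: ordered_pairs_def)
  finally show ?case
    using insert by (simp add: numeral_2_eq_2 card_insert_if) auto
qed

lemma ordered_pairs_lessThan_eq_Sigma:
  "ordered_pairs {..<l} = (\<lambda>(k, i). (i, k)) ` (SIGMA k:{..<l}. {..<k})"
  by (auto simp: ordered_pairs_def image_iff)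

lemma sum_ordered_pairs:
  fixes f :: "nat \<Rightarrow> nat \<Rightarrow> 'a :: comm_monoid_add"
  shows "(\<Sum>(i, k)\<in>ordered_pairs {..<l}. f i k) = (\<Sum>k<l. \<Sum>i<k. f i k)"
  unfolding ordered_pairs_lessThan_eq_Sigma
  by (subst sum.reindex) (auto simp: inj_on_def sum.Sigma intro!: sum.cong)

lemma prod_ordered_pairs:
  fixes f :: "nat \<Rightarrow> nat \<Rightarrow> 'a :: comm_monoid_mult"
  shows "(\<Prod>(i, k)\<in>ordered_pairs {..<l}. f i k) = (\<Prod>k<l. \<Prod>i<k. f i k)"
  unfolding ordered_pairs_lessThan_eq_Sigma
  by (subst prod.reindex) (auto simp: inj_on_def prod.Sigma intro!: prod.cong)

section \<open>Counting small subsets, and the crude and partitioned product bounds\<close>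

definition small_subsets :: "'a set \<Rightarrow> nat \<Rightarrow> 'a set set" where
  "small_subsets X d = {A. A \<subseteq> X \<and> card A \<le> d}"

lemma finite_small_subsets: "finite X \<Longrightarrow> finite (small_subsets X d)"
  by (auto simp: small_subsets_def)

lemma card_small_subsets:
  assumes "finite X"
  shows "card (small_subsets X d) = (\<Sum>k\<le>d. card X choose k)"
proof -
  have "small_subsets X d = (\<Union>k\<le>d. {A. A \<subseteq> X \<and> card A = k})"
    by (auto simp: small_subsets_def)
  also have "card \<dots> = (\<Sum>k\<le>d. card {A. A \<subseteq> X \<and> card A = k})"
    using assms by (intro card_UN_disjoint) auto
  finally show ?thesis using assms by (simp add: n_subsets)
qed

lemma card_small_subsets_le:
  assumes "finite X"
  shows "card (small_subsets X d) \<le> (card X + 1) ^ d"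
  unfolding card_small_subsets[OF assms]
proof (induction d)
  case 0
  then show ?case by simp
next
  case (Suc d)
  have "card X choose Suc d \<le> (card X choose Suc d) * fact (Suc d)"
    by (metis fact_ge_1 mult.right_neutral mult_le_mono2)
  also have "\<dots> \<le> card X ^ Suc d" by (rule binomial_fact_pow)
  also have "\<dots> \<le> card X * (card X + 1) ^ d" by (simp add: power_mono)
  finally show ?case using Suc by (simp add: algebra_simps)
qed

text \<open>Keeps the factor \<open>1 / fact d\<close> that \<open>card_small_subsets_le\<close>
  gives away. Inserting the factors \<open>d choose (d - k)\<close>, all at least 1, turns the sum
  into a Vandermonde convolution.\<close>

lemma card_small_subsets_fact_le:
  assumes "finite X"
  shows "card (small_subsets X d) * fact d \<le> (card X + d) ^ d"
proof -
  have "card (small_subsets X d) \<le> (\<Sum>k\<le>d. (card X choose k) * (d choose (d - k)))"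
    unfolding card_small_subsets[OF assms] by (intro sum_mono) (simp add: Suc_leI)
  also have "\<dots> = (card X + d) choose d" by (rule vandermonde)
  finally have "card (small_subsets X d) * fact d \<le> ((card X + d) choose d) * fact d"
    by (rule mult_right_mono) simp
  also have "\<dots> \<le> (card X + d) ^ d" by (rule binomial_fact_pow)
  finally show ?thesis .
qed

text \<open>Intersection distributes over the union behind a join, so every meet is a union of
  \<open>k\<close> sets of sizes at most \<open>d i\<close>.\<close>

lemma card_meets_iterated_joins_le:
  assumes "finite X" "\<And>i. i \<le> k \<Longrightarrow> F i \<subseteq> Pow X"
    and "\<And>i A B. i < k \<Longrightarrow> A \<in> F i \<Longrightarrow> B \<in> F k \<Longrightarrow> card (A \<inter> B) \<le> d i"
  shows "card (meets (iterated_joins F k) (F k)) \<le> (card X + 1) ^ (\<Sum>i<k. d i)"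
proof -
  have "meets (iterated_joins F k) (F k) \<subseteq> small_subsets X (\<Sum>i<k. d i)"
  proof
    fix S assume "S \<in> meets (iterated_joins F k) (F k)"
    then obtain T B where T: "T \<in> iterated_joins F k" and B: "B \<in> F k" and S: "S = T \<inter> B"
      by (auto simp: meets_def)
    from T obtain A where A: "\<And>i. i < k \<Longrightarrow> A i \<in> F i" and TA: "T = (\<Union>i<k. A i)"
      by (rule iterated_joinsE) blast
    have "card S = card (\<Union>i<k. A i \<inter> B)" unfolding S TA by (metis UN_extend_simps(4))
    also have "\<dots> \<le> (\<Sum>i<k. card (A i \<inter> B))" by (rule card_UN_le) simp
    also have "\<dots> \<le> (\<Sum>i<k. d i)" using A B assms(3) by (intro sum_mono) simp
    finally show "S \<in> small_subsets X (\<Sum>i<k. d i)"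
      using B S assms(2)[of k] by (auto simp: small_subsets_def)
  qed
  then have "card (meets (iterated_joins F k) (F k)) \<le> card (small_subsets X (\<Sum>i<k. d i))"
    using assms(1) by (intro card_mono finite_small_subsets)
  also have "\<dots> \<le> (card X + 1) ^ (\<Sum>i<k. d i)" by (rule card_small_subsets_le[OF assms(1)])
  finally show ?thesis .
qed

text \<open>The overlap bound \<open>d\<close> may vary with the pair because passing to links
  lowers it for some pairs only.\<close>

lemma prod_card_le_crude:
  assumes "finite X" "\<And>k. k < l \<Longrightarrow> F k \<subseteq> Pow X"
    and "\<And>i k A B. i < k \<Longrightarrow> k < l \<Longrightarrow> A \<in> F i \<Longrightarrow> B \<in> F k \<Longrightarrow> card (A \<inter> B) \<le> d i k"
  shows "(\<Prod>k<l. card (F k)) \<le> 2 ^ card X * (card X + 1) ^ (\<Sum>(i, k)\<in>ordered_pairs {..<l}. d i k)"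
proof -
  have "(\<Prod>k<l. card (meets (iterated_joins F k) (F k))) \<le> (\<Prod>k<l. (card X + 1) ^ (\<Sum>i<k. d i k))"
    using assms by (intro prod_mono conjI card_meets_iterated_joins_le) auto
  also have "\<dots> = (card X + 1) ^ (\<Sum>(i, k)\<in>ordered_pairs {..<l}. d i k)"
    unfolding sum_ordered_pairs by (rule power_sum[symmetric])
  finally show ?thesis
    by (intro order_trans[OF prod_card_le_iterated_meets[OF assms(1,2)]] mult_left_mono) auto
qed

lemma prod_card_le_partitioned:
  assumes "finite X" "\<And>k. k < l \<Longrightarrow> F k \<subseteq> Pow X"
    and overlap: "\<And>i k A B. i < k \<Longrightarrow> k < l \<Longrightarrow> A \<in> F i \<Longrightarrow> B \<in> F k \<Longrightarrow> card (A \<inter> B) \<le> m"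
    and e: "\<And>x. x \<in> X \<Longrightarrow> e x \<in> ordered_pairs {..<l}"
    and supp: "\<And>k A x. k < l \<Longrightarrow> A \<in> F k \<Longrightarrow> x \<in> A \<Longrightarrow> k = fst (e x) \<or> k = snd (e x)"
  shows "(\<Prod>k<l. card (F k)) \<le>
    2 ^ card X * (\<Prod>p\<in>ordered_pairs {..<l}. card (small_subsets {x\<in>X. e x = p} m))"
proof -
  \<comment> \<open>\<open>supp\<close> forces \<open>A \<inter> B\<close> into the part \<open>(i, k)\<close> whenever \<open>A \<in> F i\<close> and \<open>B \<in> F k\<close>.\<close>
  define G where "G i k = small_subsets {x\<in>X. e x = (i, k)} m" for i k
  have "card (meets (iterated_joins F k) (F k)) \<le> (\<Prod>i<k. card (G i k))" if k: "k < l" for k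
  proof -
    \<comment> \<open>A meet is determined by its traces on the parts \<open>(i, k)\<close> with
      \<open>i < k\<close>, each of size at most \<open>m\<close>; counting tuples of traces is what
      improves on the crude bound.\<close>
    have "meets (iterated_joins F k) (F k) \<subseteq> (\<lambda>A. \<Union>i<k. A i) ` (PiE {..<k} (\<lambda>i. G i k))"
    proof
      fix S assume "S \<in> meets (iterated_joins F k) (F k)"
      then obtain T B where T: "T \<in> iterated_joins F k" and B: "B \<in> F k" and S: "S = T \<inter> B"
        by (auto simp: meets_def)
      from T obtain A where A: "\<And>i. i < k \<Longrightarrow> A i \<in> F i" and TA: "T = (\<Union>i<k. A i)"
        by (rule iterated_joinsE) blast
      define D where "D = restrict (\<lambda>i. A i \<inter> B) {..<k}"
      have "S = (\<Union>i<k. D i)" unfolding S TA D_def by auto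
      moreover have "D \<in> PiE {..<k} (\<lambda>i. G i k)"
      proof (rule PiE_I)
        fix i assume "i \<in> {..<k}"
        then have i: "i < k" by simp
        have "x \<in> X \<and> e x = (i, k)" if "x \<in> A i \<inter> B" for x
        proof -
          have "x \<in> X" using that B assms(2)[OF k] by blast
          moreover have "i = fst (e x) \<or> i = snd (e x)" "k = fst (e x) \<or> k = snd (e x)"
            using that supp[of i "A i" x] supp[of k B x] A[OF i] B i k by auto
          ultimately show ?thesis
            using e[of x] i by (cases "e x") (auto simp: ordered_pairs_def)
        qed
        then show "D i \<in> G i k"
          using i overlap[OF i k A[OF i] B] by (auto simp: D_def G_def small_subsets_def)
      qed (simp add: D_def)
      ultimately show "S \<in> (\<lambda>A. \<Union>i<k. A i) ` (PiE {..<k} (\<lambda>i. G i k))" by blast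
    qed
    moreover have fin: "finite (PiE {..<k} (\<lambda>i. G i k))"
      using assms(1) by (intro finite_PiE) (auto simp: G_def intro: finite_small_subsets)
    ultimately have "card (meets (iterated_joins F k) (F k)) \<le> card (PiE {..<k} (\<lambda>i. G i k))"
      by (rule surj_card_le[rotated])
    then show ?thesis by (simp add: card_PiE)
  qed
  then have "(\<Prod>k<l. card (meets (iterated_joins F k) (F k))) \<le> (\<Prod>k<l. \<Prod>i<k. card (G i k))"
    by (intro prod_mono) auto
  also have "\<dots> = (\<Prod>p\<in>ordered_pairs {..<l}. card (small_subsets {x\<in>X. e x = p} m))"
    unfolding prod_ordered_pairs[symmetric] by (rule prod.cong) (auto simp: G_def)
  finally show ?thesis
    by (intro order_trans[OF prod_card_le_iterated_meets[OF assms(1,2)]] mult_left_mono) auto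
qed

lemma prod_le_mean_power:
  fixes x :: "'a \<Rightarrow> real"
  assumes "finite S" "S \<noteq> {}" "\<And>i. i \<in> S \<Longrightarrow> 0 \<le> x i"
  shows "(\<Prod>i\<in>S. x i) \<le> ((\<Sum>i\<in>S. x i) / card S) ^ card S"
proof -
  have pos: "card S > 0" and nn: "0 \<le> (\<Prod>i\<in>S. x i)"
    using assms by (auto simp: card_gt_0_iff intro: prod_nonneg)
  have "(\<Prod>i\<in>S. x i) = ((\<Prod>i\<in>S. x i) powr (1 / card S)) ^ card S"
    \<comment> \<open>A vanishing product is treated apart because \<open>powr_realpow\<close> asks
      for a positive base.\<close>
    using pos nn by (cases "(\<Prod>i\<in>S. x i) = 0") (auto simp: powr_realpow[symmetric] powr_powr)
  also have "\<dots> \<le> (\<Sum>i\<in>S. x i / card S) ^ card S"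
    by (intro power_mono arith_geom_mean assms) auto
  finally show ?thesis by (simp add: sum_divide_distrib)
qed

section \<open>The upper bound\<close>

text \<open>The families are indexed from \<open>0\<close> here, and from \<open>1\<close> in \<^const>\<open>overlapping\<close>.\<close>

definition overlapping_on :: "'a set \<Rightarrow> nat \<Rightarrow> nat \<Rightarrow> (nat \<Rightarrow> 'a set set) \<Rightarrow> bool" where
  "overlapping_on X l m F \<longleftrightarrow> (\<forall>k<l. F k \<subseteq> Pow X) \<and>
     (\<forall>i k. i < k \<longrightarrow> k < l \<longrightarrow> (\<forall>A\<in>F i. \<forall>B\<in>F k. card (A \<inter> B) \<le> m))"

lemma overlapping_onD:
  assumes "overlapping_on X l m F"
  shows "k < l \<Longrightarrow> F k \<subseteq> Pow X"
    and "i < k \<Longrightarrow> k < l \<Longrightarrow> A \<in> F i \<Longrightarrow> B \<in> F k \<Longrightarrow> card (A \<inter> B) \<le> m"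
  using assms by (auto simp: overlapping_on_def)

section \<open>Deletions, links and point densities\<close>

lemma overlapping_on_deletion:
  assumes "overlapping_on X l m F"
  shows "overlapping_on (X - {x}) l m (\<lambda>k. deletion x (F k))"
  using assms unfolding overlapping_on_def deletion_def by fast

text \<open>Restoring \<open>x\<close> to two members of links enlarges their intersection by one
  point, so pairs inside \<open>S\<close> obey the bound \<open>m - 1\<close>. For the other pairs
  restoring \<open>x\<close> cannot shrink the intersection, and \<open>m\<close> remains valid. The
  crude bound does the rest.\<close>

lemma prod_card_link_le:
  assumes X: "finite X" and F: "overlapping_on X l m F" and S: "S \<subseteq> {..<l}" and m: "m > 0"
  shows "(\<Prod>k<l. card (if k \<in> S then link x (F k) else F k))
    \<le> 2 ^ card X * (card X + 1) ^ (m * (l choose 2) - (card S choose 2))"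
proof -
  define G where "G k = (if k \<in> S then link x (F k) else F k)" for k
  define d where "d i k = m - (if i \<in> S \<and> k \<in> S then 1 else 0)" for i k
  have fin: "finite A" if "k < l" "A \<in> F k" for k A
    using overlapping_onD(1)[OF F that(1)] that(2) X by (auto intro: finite_subset)
  have "card (A \<inter> B) \<le> d i k" if ik: "i < k" "k < l" and A: "A \<in> G i" and B: "B \<in> G k" for i k A B
  proof -
    define A' B' where "A' = (if i \<in> S then insert x A else A)"
      and "B' = (if k \<in> S then insert x B else B)"
    have A': "A' \<in> F i" and B': "B' \<in> F k"
      using A B by (auto simp: G_def A'_def B'_def link_def split: if_splits)
    have le: "card (A' \<inter> B') \<le> m" by (rule overlapping_onD(2)[OF F ik A' B'])
    have fin': "finite (A' \<inter> B')" using fin[OF ik(2) B'] by simp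
    show ?thesis
    proof (cases "i \<in> S \<and> k \<in> S")
      case True
      then have "A' \<inter> B' = insert x (A \<inter> B)" "x \<notin> A \<inter> B"
        using A by (auto simp: A'_def B'_def G_def link_def)
      then show ?thesis using le fin' True by (simp add: d_def)
    next
      case False
      have "card (A \<inter> B) \<le> card (A' \<inter> B')"
        by (rule card_mono[OF fin']) (auto simp: A'_def B'_def)
      then have "card (A \<inter> B) \<le> m" using le by simp
      then show ?thesis using False by (auto simp: d_def)
    qed
  qed
  moreover have "G k \<subseteq> Pow X" if "k < l" for k
    using overlapping_onD(1)[OF F that] by (auto simp: G_def link_def)
  ultimately have "(\<Prod>k<l. card (G k)) \<le>
      2 ^ card X * (card X + 1) ^ (\<Sum>(i, k)\<in>ordered_pairs {..<l}. d i k)"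
    by (intro prod_card_le_crude X)
  also have "(\<Sum>(i, k)\<in>ordered_pairs {..<l}. d i k) =
      (\<Sum>p\<in>ordered_pairs {..<l}. m - (if p \<in> ordered_pairs S then 1 else 0))"
    using S by (intro sum.cong) (auto simp: d_def ordered_pairs_def split: if_splits)
  \<comment> \<open>\<open>m > 0\<close> keeps the natural-number subtraction from
    truncating.\<close>
  also have "\<dots> = (\<Sum>p\<in>ordered_pairs {..<l}. m) - (\<Sum>p\<in>ordered_pairs {..<l}. if p \<in> ordered_pairs S then 1 else 0)"
    by (rule sum_subtractf_nat) (use m in simp)
  also have "(\<Sum>p\<in>ordered_pairs {..<l}. if p \<in> ordered_pairs S then 1 else 0) =
      card (ordered_pairs {..<l} \<inter> ordered_pairs S)"
    by (simp add: sum.If_cases finite_ordered_pairs)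
  also have "ordered_pairs {..<l} \<inter> ordered_pairs S = ordered_pairs S"
    using S by (auto simp: ordered_pairs_def)
  finally show ?thesis
    using finite_subset[OF S] by (simp add: G_def card_ordered_pairs mult.commute)
qed

text \<open>The probability that a random member contains \<open>x\<close>, by the bijection between
  the link and the members through \<open>x\<close>. For an empty family the value is 0.\<close>

definition point_density :: "'a \<Rightarrow> 'a set set \<Rightarrow> real" where
  "point_density x \<A> = card (link x \<A>) / card \<A>"

lemma point_density_nonneg: "0 \<le> point_density x \<A>"
  by (simp add: point_density_def)

text \<open>Multiplying by all family sizes turns the densities over \<open>S\<close> into link
  sizes, which \<open>prod_card_link_le\<close> bounds; dividing by the lower bound
  \<open>large\<close> leaves the stated power of \<open>card X\<close>. The power of 2 pays for
  replacing \<open>card X + 1\<close> by \<open>2 * card X\<close>.\<close>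

lemma prod_point_density_le:
  fixes \<kappa> :: real
  assumes X: "finite X" "X \<noteq> {}" and F: "overlapping_on X l m F" and S: "S \<subseteq> {..<l}" and m: "m > 0"
    and \<kappa>: "\<kappa> > 0"
    and large: "\<kappa> * card X ^ (m * (l choose 2)) * 2 ^ card X < (\<Prod>k<l. card (F k))"
  shows "(\<Prod>k\<in>S. point_density x (F k)) \<le> 2 ^ (m * (l choose 2)) / \<kappa> / card X ^ (card S choose 2)"
proof -
  define n D c where "n = real (card X)" and "D = m * (l choose 2)" and "c = card S choose 2"
  define P where "P = (\<Prod>k<l. real (card (F k)))"
  define Q where "Q = (\<Prod>k\<in>S. point_density x (F k))"
  have n: "n \<ge> 1" using X by (simp add: n_def Suc_leI card_gt_0_iff)
  have large: "\<kappa> * n ^ D * 2 ^ card X < P" using large by (simp add: n_def D_def P_def)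
  have Q0: "Q \<ge> 0" unfolding Q_def by (intro prod_nonneg point_density_nonneg)
  have "card S \<le> l" using card_mono[OF _ S] by simp
  then have "c \<le> l choose 2" unfolding c_def by (rule binomial_right_mono)
  also have "\<dots> \<le> D" using m by (simp add: D_def)
  finally have cD: "c \<le> D" .
  have pos: "card (F k) \<noteq> 0" if "k < l" for k
  proof
    assume "card (F k) = 0"
    then have "P = 0" using that unfolding P_def by (intro prod_zero) auto
    moreover have "0 \<le> \<kappa> * n ^ D * 2 ^ card X" using \<kappa> n by simp
    ultimately show False using large by simp
  qed
  have "Q * P = (\<Prod>k<l. if k \<in> S then point_density x (F k) else 1) * P"
    using S unfolding Q_def
    by (subst prod.inter_restrict[symmetric]) (auto simp: Int_absorb1)
  also have "\<dots> = (\<Prod>k<l. (if k \<in> S then point_density x (F k) else 1) * card (F k))"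
    unfolding P_def by (rule prod.distrib[symmetric])
  also have "\<dots> = (\<Prod>k<l. real (card (if k \<in> S then link x (F k) else F k)))"
    using pos by (intro prod.cong) (auto simp: point_density_def)
  also have "\<dots> \<le> real (2 ^ card X * (card X + 1) ^ (D - c))"
    using prod_card_link_le[OF X(1) F S m, of x] unfolding D_def c_def
    by (subst of_nat_prod[symmetric], subst of_nat_le_iff)
  also have "\<dots> = 2 ^ card X * (n + 1) ^ (D - c)" by (simp add: n_def add.commute)
  finally have "Q * P \<le> 2 ^ card X * (n + 1) ^ (D - c)" .
  then have "Q * (\<kappa> * n ^ D * 2 ^ card X) \<le> 2 ^ card X * (n + 1) ^ (D - c)"
    using mult_left_mono[OF less_imp_le[OF large] Q0] by linarith
  then have "(Q * (\<kappa> * n ^ D)) * 2 ^ card X \<le> (n + 1) ^ (D - c) * 2 ^ card X"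
    by (simp only: mult_ac)
  then have "Q * (\<kappa> * n ^ D) \<le> (n + 1) ^ (D - c)" by simp
  also have "\<dots> \<le> (2 * n) ^ (D - c)" using n by (intro power_mono) auto
  also have "\<dots> \<le> 2 ^ D * n ^ (D - c)"
    using n by (simp add: power_mult_distrib mult_right_mono power_increasing)
  finally have "Q * (\<kappa> * n ^ D) \<le> 2 ^ D * n ^ (D - c)" .
  moreover have "n ^ D = n ^ (D - c) * n ^ c" using cD by (simp flip: power_add)
  ultimately have "(Q * \<kappa> * n ^ c) * n ^ (D - c) \<le> 2 ^ D * n ^ (D - c)"
    by (simp add: mult_ac)
  then have "Q * \<kappa> * n ^ c \<le> 2 ^ D" using n by simp
  then show ?thesis
    using \<kappa> n by (simp add: Q_def[symmetric] D_def[symmetric] c_def[symmetric] n_def[symmetric] field_simps)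
qed

lemma card_deletion_point_density:
  assumes "finite \<A>" "card \<A> \<noteq> 0"
  shows "real (card (deletion x \<A>)) = card \<A> * (1 - point_density x \<A>)"
proof -
  have "card \<A> * point_density x \<A> = card (link x \<A>)"
    using assms(2) by (simp add: point_density_def)
  then show ?thesis
    using card_deletion_link[OF assms(1), of x] by (simp add: right_diff_distrib)
qed

section \<open>The two cases: a point of small density, and two dominant families at every
  point\<close>

lemma ex_largest:
  fixes f :: "'a \<Rightarrow> 'b :: linorder"
  assumes "finite A" "A \<noteq> {}"
  obtains a where "a \<in> A" "\<And>k. k \<in> A \<Longrightarrow> f k \<le> f a"
proof -
  have "Max (f ` A) \<in> f ` A" using assms by simp
  then obtain a where "a \<in> A" "f a = Max (f ` A)" by auto
  then show thesis using that assms(1) by simp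
qed

lemma ex_two_largest:
  fixes f :: "nat \<Rightarrow> real"
  assumes "l \<ge> 2"
  obtains a b where "a < l" "b < l" "a \<noteq> b" "\<And>k. k < l \<Longrightarrow> f k \<le> f a"
    "\<And>k. k < l \<Longrightarrow> k \<noteq> a \<Longrightarrow> f k \<le> f b"
proof -
  obtain a where a: "a < l" "\<And>k. k < l \<Longrightarrow> f k \<le> f a"
    using ex_largest[of "{..<l}" f] assms by (auto simp: lessThan_empty_iff)
  have "(if a = 0 then 1 else 0) \<in> {..<l} - {a}" using assms by auto
  then have "{..<l} - {a} \<noteq> {}" by blast
  then obtain b where "b \<in> {..<l} - {a}" "\<And>k. k \<in> {..<l} - {a} \<Longrightarrow> f k \<le> f b"
    using ex_largest[of "{..<l} - {a}" f] by auto
  then show thesis using a that by auto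
qed

text \<open>The square of any density but the largest is at most a product of two densities, hence
  at most \<open>K / card X\<close>. With the largest at most 1/3, the proportion of tuples avoiding
  \<open>x\<close> is at least 2/3 times 15/16, which is 5/8. What matters is that
  \<open>8 / 5\<close> is below 2, the growth of \<open>2 ^ card X\<close> per point.\<close>

lemma prod_card_le_deletion:
  fixes \<kappa> K :: real
  assumes X: "finite X" "X \<noteq> {}" and F: "overlapping_on X l m F" and m: "m > 0" and l: "l > 0"
    and \<kappa>: "\<kappa> > 0" and K: "K = 2 ^ (m * (l choose 2)) / \<kappa>"
    and large: "\<kappa> * card X ^ (m * (l choose 2)) * 2 ^ card X < (\<Prod>k<l. card (F k))"
    and small: "\<And>k. k < l \<Longrightarrow> point_density x (F k) \<le> 1 / 3"
    and n: "l * sqrt (K / card X) \<le> 1 / 16"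
  shows "real (\<Prod>k<l. card (F k)) \<le> 8 / 5 * (\<Prod>k<l. card (deletion x (F k)))"
proof -
  define s where "s = sqrt (K / card X)"
  have s0: "s \<ge> 0" using K \<kappa> by (simp add: s_def)
  obtain a where a: "a < l" "\<And>k. k < l \<Longrightarrow> point_density x (F k) \<le> point_density x (F a)"
    using ex_largest[of "{..<l}" "\<lambda>k. point_density x (F k)"] l by auto
  have density_le: "point_density x (F k) \<le> s" if k: "k < l" "k \<noteq> a" for k
  proof -
    have "point_density x (F k) ^ 2 \<le> point_density x (F a) * point_density x (F k)"
      using a(2)[OF k(1)] by (simp add: power2_eq_square mult_right_mono point_density_nonneg)
    also have "\<dots> = (\<Prod>k\<in>{a, k}. point_density x (F k))" using k by simp
    also have "\<dots> \<le> K / card X ^ (card {a, k} choose 2)"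
      unfolding K using a(1) k by (intro prod_point_density_le[OF X F _ m \<kappa> large]) auto
    also have "\<dots> = K / card X" using k by (simp add: numeral_2_eq_2)
    finally show ?thesis unfolding s_def by (rule real_le_rsqrt)
  qed
  have pos: "card (F k) \<noteq> 0" and fin: "finite (F k)" if "k < l" for k
  proof -
    show "card (F k) \<noteq> 0"
    proof
      assume "card (F k) = 0"
      then have "real (\<Prod>k<l. card (F k)) = 0"
        using that unfolding of_nat_prod by (intro prod_zero) auto
      moreover have "0 \<le> \<kappa> * card X ^ (m * (l choose 2)) * 2 ^ card X" using \<kappa> by simp
      ultimately show False using large by linarith
    qed
    then show "finite (F k)" by (metis card.infinite)
  qed
  have s1: "s \<le> 1"
  proof -
    have "1 * s \<le> l * s" using l s0 by (intro mult_right_mono) auto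
    then show ?thesis using n unfolding s_def by linarith
  qed
  have "15 / 16 \<le> 1 - l * s" using n by (simp add: s_def)
  also have "\<dots> \<le> 1 - (l - 1) * s" using s0 by (simp add: mult_right_mono)
  also have "\<dots> \<le> (1 - s) ^ (l - 1)" using Bernoulli_inequality[of "- s" "l - 1"] s1 by simp
  also have "\<dots> = (\<Prod>k\<in>{..<l} - {a}. 1 - s)" using a(1) by simp
  also have "\<dots> \<le> (\<Prod>k\<in>{..<l} - {a}. 1 - point_density x (F k))"
    using density_le s1 by (intro prod_mono) auto
  finally have "2 / 3 * (15 / 16) \<le> (1 - point_density x (F a)) * (\<Prod>k\<in>{..<l} - {a}. 1 - point_density x (F k))"
    using small[OF a(1)] by (intro mult_mono) auto
  also have "\<dots> = (\<Prod>k<l. 1 - point_density x (F k))"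
    using a(1) by (subst (2) prod.remove[of _ a]) auto
  finally have "5 / 8 * (\<Prod>k<l. real (card (F k))) \<le> (\<Prod>k<l. 1 - point_density x (F k)) * (\<Prod>k<l. real (card (F k)))"
    by (intro mult_right_mono prod_nonneg) auto
  also have "\<dots> = (\<Prod>k<l. real (card (deletion x (F k))))"
    unfolding prod.distrib[symmetric]
    using pos fin by (intro prod.cong) (auto simp: card_deletion_point_density)
  finally show ?thesis by simp
qed

text \<open>A part with \<open>v\<close> points has at most \<open>(v + m) ^ m / fact m\<close>
  small subsets. By AM-GM the product over the parts is largest for equal parts, and the quantities
  \<open>v + m\<close> sum to \<open>card X + m * (l choose 2)\<close>.\<close>

lemma prod_small_subsets_le:
  assumes X: "finite X" and l: "l \<ge> 2" and e: "\<And>x. x \<in> X \<Longrightarrow> e x \<in> ordered_pairs {..<l}"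
  shows "real (\<Prod>p\<in>ordered_pairs {..<l}. card (small_subsets {x\<in>X. e x = p} m)) \<le>
    (1 / (fact m * real (l choose 2) ^ m)) ^ (l choose 2) * (card X + m * (l choose 2)) ^ (m * (l choose 2))"
proof -
  define E M where "E = ordered_pairs {..<l}" and "M = l choose 2"
  define v where "v p = card {x\<in>X. e x = p}" for p
  have E: "finite E" "card E = M" by (simp_all add: E_def M_def finite_ordered_pairs card_ordered_pairs)
  have M: "M > 0" using l by (simp add: M_def)
  have "card X = card (\<Union>p\<in>E. {x\<in>X. e x = p})" using e by (intro arg_cong[where f = card]) (auto simp: E_def)
  also have "\<dots> = (\<Sum>p\<in>E. v p)"
    unfolding v_def using X E by (intro card_UN_disjoint) auto
  finally have sum_v: "(\<Sum>p\<in>E. v p) = card X" ..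
  have "real (card (small_subsets {x\<in>X. e x = p} m)) \<le> (v p + m) ^ m / fact m" for p
  proof -
    have "card (small_subsets {x\<in>X. e x = p} m) * fact m \<le> (v p + m) ^ m"
      unfolding v_def using X by (intro card_small_subsets_fact_le) auto
    then have "real (card (small_subsets {x\<in>X. e x = p} m) * fact m) \<le> real ((v p + m) ^ m)"
      by (simp only: of_nat_le_iff)
    then show ?thesis by (simp add: field_simps)
  qed
  then have "real (\<Prod>p\<in>E. card (small_subsets {x\<in>X. e x = p} m)) \<le> (\<Prod>p\<in>E. (v p + m) ^ m / fact m)"
    unfolding of_nat_prod by (intro prod_mono) auto
  also have "\<dots> = (\<Prod>p\<in>E. real (v p + m)) ^ m / fact m ^ M"
    using E by (simp add: prod_dividef prod_power_distrib)
  also have "\<dots> \<le> (((\<Sum>p\<in>E. real (v p + m)) / card E) ^ card E) ^ m / fact m ^ M"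
    using E M by (intro divide_right_mono power_mono prod_le_mean_power prod_nonneg) auto
  also have "(\<Sum>p\<in>E. real (v p + m)) = card X + m * M"
    using sum_v E by (simp add: sum.distrib flip: of_nat_sum)
  also have "((real (card X + m * M) / card E) ^ card E) ^ m / fact m ^ M =
      (1 / (fact m * real M ^ m)) ^ M * (card X + m * M) ^ (m * M)"
    using E(2) by (simp add: power_divide power_mult_distrib mult.commute flip: power_mult)
  finally show ?thesis unfolding E_def M_def by simp
qed

text \<open>Each family drops its members containing a point assigned to two other families. By a
  union bound over at most \<open>card X\<close> points this costs a proportion at most
  \<open>sqrt (3 * K / card X)\<close> per family. The rest satisfies
  \<open>prod_card_le_partitioned\<close>, and \<open>prod_small_subsets_le\<close> supplies the
  sharp constant.\<close>

lemma prod_card_le_structured: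
  fixes \<kappa> K :: real
  assumes X: "finite X" "X \<noteq> {}" and F: "overlapping_on X l m F" and m: "m > 0" and l: "l \<ge> 2"
    and \<kappa>: "\<kappa> = (1 / (fact m * real (l choose 2) ^ m)) ^ (l choose 2)"
    and K: "K = 2 ^ (m * (l choose 2)) / \<kappa>"
    and large: "\<kappa> * card X ^ (m * (l choose 2)) * 2 ^ card X < (\<Prod>k<l. card (F k))"
    and third: "\<And>x. x \<in> X \<Longrightarrow> \<exists>k<l. point_density x (F k) > 1 / 3"
    and n: "sqrt (3 * K / card X) \<le> 1"
  shows "real (\<Prod>k<l. card (F k)) * (1 - l * sqrt (3 * K / card X)) \<le>
    \<kappa> * (card X + m * (l choose 2)) ^ (m * (l choose 2)) * 2 ^ card X"
proof -
  define t where "t = sqrt (3 * K / card X)"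
  have n0: "real (card X) > 0" using X by (simp add: card_gt_0_iff)
  have \<kappa>0: "\<kappa> > 0" using l by (simp add: \<kappa>)
  have t0: "t \<ge> 0" using K \<kappa>0 by (simp add: t_def)
  have "\<exists>p\<in>ordered_pairs {..<l}. \<forall>k<l. k \<noteq> fst p \<longrightarrow> k \<noteq> snd p \<longrightarrow> point_density x (F k) \<le> t / card X"
    if x: "x \<in> X" for x
  proof -
    obtain a b where ab: "a < l" "b < l" "a \<noteq> b"
      and fa: "\<And>k. k < l \<Longrightarrow> point_density x (F k) \<le> point_density x (F a)"
      and fb: "\<And>k. k < l \<Longrightarrow> k \<noteq> a \<Longrightarrow> point_density x (F k) \<le> point_density x (F b)"
      using ex_two_largest[OF l, of "\<lambda>k. point_density x (F k)"] by metis
    have "1 / 3 < point_density x (F a)" using third[OF x] fa by (meson less_le_trans)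
    \<comment> \<open>The density at \<open>a\<close> exceeds 1/3 and that at \<open>b\<close> is at
      least that at \<open>k\<close>, so the square of the latter is at most 3 times a product of
      three densities. Three indices span three pairs, hence the bound
      \<open>3 * K / card X ^ 3\<close>.\<close>
    have "point_density x (F k) \<le> t / card X" if k: "k < l" "k \<noteq> a" "k \<noteq> b" for k
    proof -
      have "point_density x (F k) ^ 2 \<le> point_density x (F b) * point_density x (F k)"
        using fb[OF k(1,2)] by (simp add: power2_eq_square mult_right_mono point_density_nonneg)
      also have "\<dots> \<le> 3 * point_density x (F a) * (point_density x (F b) * point_density x (F k))"
        using \<open>1 / 3 < point_density x (F a)\<close> mult_right_mono[of 1 "3 * point_density x (F a)" "point_density x (F b) * point_density x (F k)"]
        by (simp add: point_density_nonneg)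
      also have "\<dots> = 3 * (\<Prod>k\<in>{a, b, k}. point_density x (F k))" using k ab by simp
      also have "\<dots> \<le> 3 * (K / card X ^ (card {a, b, k} choose 2))"
        unfolding K using ab k by (intro mult_left_mono prod_point_density_le[OF X F _ m \<kappa>0 large]) auto
      also have "\<dots> = 3 * K / card X ^ 3" using k ab by (simp add: numeral_3_eq_3 numeral_2_eq_2)
      also have "\<dots> = (t / card X) ^ 2"
        using K \<kappa>0 by (simp add: t_def power_divide power2_eq_square power3_eq_cube)
      finally show ?thesis using t0 by (auto intro: power2_le_imp_le)
    qed
    then show ?thesis
      using ab by (intro bexI[of _ "(min a b, max a b)"]) (auto simp: ordered_pairs_def min_def max_def)
  qed
  then obtain e where e: "\<And>x. x \<in> X \<Longrightarrow> e x \<in> ordered_pairs {..<l}"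
    and density_e: "\<And>x k. x \<in> X \<Longrightarrow> k < l \<Longrightarrow> k \<noteq> fst (e x) \<Longrightarrow> k \<noteq> snd (e x) \<Longrightarrow> point_density x (F k) \<le> t / card X"
    by metis
  \<comment> \<open>Each \<open>x\<close> is kept only in the two families where it is densest.\<close>
  define G where "G k = {A \<in> F k. \<forall>x\<in>A. k = fst (e x) \<or> k = snd (e x)}" for k
  have card_G: "card (F k) * (1 - t) \<le> card (G k)" if k: "k < l" for k
  proof -
    define Y where "Y = {x\<in>X. k \<noteq> fst (e x) \<and> k \<noteq> snd (e x)}"
    have FX: "F k \<subseteq> Pow X" by (rule overlapping_onD(1)[OF F k])
    then have fin: "finite (F k)" using X(1) by (simp add: finite_subset)
    have Y: "finite Y" "card Y \<le> card X" using X(1) by (auto simp: Y_def intro: card_mono)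
    have "F k \<subseteq> G k \<union> (\<Union>x\<in>Y. {A \<in> F k. x \<in> A})" using FX by (auto simp: G_def Y_def)
    then have "card (F k) \<le> card (G k \<union> (\<Union>x\<in>Y. {A \<in> F k. x \<in> A}))"
      using fin Y by (intro card_mono) (auto simp: G_def)
    also have "\<dots> \<le> card (G k) + card (\<Union>x\<in>Y. {A \<in> F k. x \<in> A})" by (rule card_Un_le)
    also have "\<dots> \<le> card (G k) + (\<Sum>x\<in>Y. card {A \<in> F k. x \<in> A})"
      by (intro add_left_mono card_UN_le Y)
    finally have "real (card (F k)) \<le> real (card (G k)) + (\<Sum>x\<in>Y. real (card (link x (F k))))"
      unfolding card_link by (simp flip: of_nat_sum of_nat_add)
    also have "(\<Sum>x\<in>Y. real (card (link x (F k)))) \<le> (\<Sum>x\<in>Y. card (F k) * (t / card X))"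
    proof (rule sum_mono)
      fix x assume "x \<in> Y"
      then have "point_density x (F k) \<le> t / card X" using density_e k by (auto simp: Y_def)
      moreover have "card (link x (F k)) = card (F k) * point_density x (F k)"
        using card_deletion_link[OF fin, of x] by (auto simp: point_density_def)
      ultimately show "real (card (link x (F k))) \<le> card (F k) * (t / card X)"
        by (simp only: mult_left_mono of_nat_0_le_iff)
    qed
    also have "\<dots> = card Y * (card (F k) * (t / card X))" by simp
    also have "\<dots> \<le> card X * (card (F k) * (t / card X))"
      using Y(2) t0 by (intro mult_right_mono) auto
    also have "\<dots> = card (F k) * t" using n0 by simp
    finally show ?thesis by (simp add: algebra_simps)
  qed
  have "real (\<Prod>k<l. card (F k)) * (1 - l * t) \<le> real (\<Prod>k<l. card (F k)) * (1 - t) ^ l"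
    using Bernoulli_inequality[of "- t" l] n by (intro mult_left_mono of_nat_0_le_iff) (simp add: t_def)
  also have "\<dots> = (\<Prod>k<l. card (F k) * (1 - t))" by (simp add: prod.distrib)
  also have "\<dots> \<le> real (\<Prod>k<l. card (G k))"
    unfolding of_nat_prod using card_G n by (intro prod_mono) (auto simp: t_def)
  also have "\<dots> \<le> real (2 ^ card X * (\<Prod>p\<in>ordered_pairs {..<l}. card (small_subsets {x\<in>X. e x = p} m)))"
    unfolding of_nat_le_iff
  proof (rule prod_card_le_partitioned[OF X(1)])
    show "G k \<subseteq> Pow X" if "k < l" for k using overlapping_onD(1)[OF F that] by (auto simp: G_def)
    show "card (A \<inter> B) \<le> m" if "i < k" "k < l" "A \<in> G i" "B \<in> G k" for i k A B
      using that overlapping_onD(2)[OF F that(1,2), of A B] by (auto simp: G_def)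
  qed (use e in \<open>auto simp: G_def\<close>)
  also have "\<dots> \<le> 2 ^ card X * (\<kappa> * (card X + m * (l choose 2)) ^ (m * (l choose 2)))"
    using prod_small_subsets_le[where m = m and e = e, OF X(1) l e] unfolding \<kappa> by simp
  finally show ?thesis by (simp add: t_def mult_ac)
qed

text \<open>The right side is the chord over the unit interval of a convex function of
  \<open>u\<close>; the induction only needs that the square of \<open>u\<close> is at most
  \<open>u\<close>.\<close>

lemma one_plus_power_le:
  fixes a u :: real
  assumes "0 \<le> a" "0 \<le> u" "u \<le> 1"
  shows "(1 + a * u) ^ b \<le> 1 + ((1 + a) ^ b - 1) * u"
proof (induction b)
  case 0
  then show ?case by simp
next
  case (Suc b)
  define z where "z = (1 + a) ^ b - 1"
  have z: "z \<ge> 0" using assms by (simp add: z_def)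
  have "(1 + a * u) ^ Suc b \<le> (1 + a * u) * (1 + z * u)"
    using Suc assms by (simp add: z_def mult_left_mono)
  also have "\<dots> = 1 + (a + z) * u + (a * z * u) * u" by (simp add: algebra_simps)
  also have "\<dots> \<le> 1 + (a + z) * u + (a * z * u) * 1"
    using assms z by (intro add_left_mono mult_left_mono) auto
  also have "\<dots> = 1 + ((1 + a) * (1 + z) - 1) * u" by (simp add: algebra_simps)
  finally show ?case by (simp add: z_def)
qed

text \<open>Induction on the size of the ground set. Either the product is already at most the main
  term, or some point has all densities at most 1/3 and is deleted, or the structured bound applies
  directly. Only the deletion case uses the induction hypothesis.\<close>

theorem prod_card_upper_bound:
  fixes l m :: nat
  assumes l: "l \<ge> 2"
  defines "\<kappa> \<equiv> (1 / (fact m * real (l choose 2) ^ m)) ^ (l choose 2)"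
  obtains C :: real and n\<^sub>0 :: nat where
    "\<And>(X :: 'a set) F. finite X \<Longrightarrow> n\<^sub>0 \<le> card X \<Longrightarrow> overlapping_on X l m F \<Longrightarrow>
      real (\<Prod>k<l. card (F k)) \<le>
        (1 + C / sqrt (card X)) * (\<kappa> * real (card X) ^ (m * (l choose 2)) * 2 ^ card X)"
proof (cases "m = 0")
  \<comment> \<open>Separate because links lower \<open>m\<close> by one. Here the crude bound is
    already \<open>2 ^ card X\<close>, and \<open>\<kappa>\<close> is 1.\<close>
  case True
  show thesis
  proof (rule that[of 0 0])
    fix X :: "'a set" and F assume X: "finite X" and F: "overlapping_on X l m F"
    have "(\<Prod>k<l. card (F k)) \<le> 2 ^ card X * (card X + 1) ^ (\<Sum>(i, k)\<in>ordered_pairs {..<l}. 0)"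
      using overlapping_onD[OF F] True by (intro prod_card_le_crude X) auto
    then have "(\<Prod>k<l. card (F k)) \<le> 2 ^ card X" by simp
    then have "real (\<Prod>k<l. card (F k)) \<le> real (2 ^ card X)" by (simp only: of_nat_le_iff)
    then show "real (\<Prod>k<l. card (F k)) \<le>
        (1 + 0 / sqrt (card X)) * (\<kappa> * real (card X) ^ (m * (l choose 2)) * 2 ^ card X)"
      using True by (simp add: \<kappa>_def)
  qed
next
  case False
  then have m: "m > 0" by simp
  define D where "D = m * (l choose 2)"
  define K where "K = 2 ^ D / \<kappa>"
  define c where "c = l * sqrt (3 * K)"
  define B where "B = (1 + real D) ^ D - 1"
  \<comment> \<open>The square gives \<open>c / sqrt n <= 1 / 16\<close>, which covers the smallness
    conditions of both cases; the 3 secures \<open>16 / 25 * n <= n - 1\<close> in the deletion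
    case.\<close>
  define n\<^sub>0 where "n\<^sub>0 = max 3 (nat \<lceil>(16 * c) ^ 2\<rceil>)"
  \<comment> \<open>The first entry starts the induction, the second collects the errors of the
    structured case; the deletion case works for every nonnegative \<open>C\<close>.\<close>
  define C where "C = max (sqrt n\<^sub>0 * K) (2 * c + B + 2 * c * B)"
  define T where "T n = \<kappa> * real n ^ D * 2 ^ n" for n :: nat
  have \<kappa>: "\<kappa> > 0" using l by (simp add: \<kappa>_def)
  have K: "K > 0" using \<kappa> by (simp add: K_def)
  have c: "c \<ge> 0" and B: "B \<ge> 0" using K by (simp_all add: c_def B_def)
  have C: "C \<ge> 0" using K by (simp add: C_def le_max_iff_disj)
  have n0: "n\<^sub>0 \<ge> 3" by (simp add: n\<^sub>0_def)
  have T: "T n \<ge> 0" for n using \<kappa> by (simp add: T_def)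
  have c_le: "c / sqrt n \<le> 1 / 16" if "n \<ge> n\<^sub>0" for n
  proof -
    have "(16 * c) ^ 2 \<le> n" using that unfolding n\<^sub>0_def by linarith
    then have "16 * c \<le> sqrt n" by (rule real_le_rsqrt)
    then show ?thesis using that n0 by (simp add: field_simps)
  qed
  have main: "real (\<Prod>k<l. card (F k)) \<le> (1 + C / sqrt n) * T n"
    if "n \<ge> n\<^sub>0" "finite X" "card X = n" "overlapping_on X l m F" for n and X :: "'a set" and F
    using that
  proof (induction n arbitrary: X F rule: dec_induct)
    case base
    have "(\<Prod>k<l. card (F k)) \<le> 2 ^ card X * (card X + 1) ^ (\<Sum>(i, k)\<in>ordered_pairs {..<l}. m)"
      using overlapping_onD[OF base(3)] base by (intro prod_card_le_crude) auto
    also have "\<dots> = 2 ^ n\<^sub>0 * (n\<^sub>0 + 1) ^ D"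
      using base by (simp add: card_ordered_pairs D_def mult.commute)
    also have "\<dots> \<le> 2 ^ n\<^sub>0 * (2 * n\<^sub>0) ^ D"
      using n0 by (intro mult_left_mono power_mono) auto
    finally have "real (\<Prod>k<l. card (F k)) \<le> real (2 ^ n\<^sub>0 * (2 * n\<^sub>0) ^ D)"
      by (simp only: of_nat_le_iff)
    \<comment> \<open>At \<open>n\<^sub>0\<close> the crude bound is off by the constant factor
      \<open>K\<close>, which \<open>C / sqrt n\<^sub>0\<close> absorbs.\<close>
    also have "\<dots> = K * T n\<^sub>0" using \<kappa> by (simp add: K_def T_def power_mult_distrib)
    also have "\<dots> \<le> (1 + C / sqrt n\<^sub>0) * T n\<^sub>0"
    proof (intro mult_right_mono T)
      have "K * sqrt n\<^sub>0 \<le> C" unfolding C_def by (simp add: mult.commute)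
      then have "K \<le> C / sqrt n\<^sub>0" using n0 by (simp add: field_simps)
      then show "K \<le> 1 + C / sqrt n\<^sub>0" by simp
    qed
    finally show ?case .
  next
    case (step n')
    define n where "n = Suc n'"
    have n: "n \<ge> n\<^sub>0" "real n > 0" "card X = n" using step by (auto simp: n_def)
    have X: "finite X" "X \<noteq> {}" using step.prems by auto
    note F = step.prems(3)
    show ?case unfolding n_def[symmetric]
    proof (cases "real (\<Prod>k<l. card (F k)) \<le> T n")
      case True
      also have "T n \<le> (1 + C / sqrt n) * T n"
        using mult_right_mono[OF _ T, of 1 "1 + C / sqrt n" n] C by simp
      finally show "real (\<Prod>k<l. card (F k)) \<le> (1 + C / sqrt n) * T n" .
    next
      case False
      then have large: "\<kappa> * card X ^ (m * (l choose 2)) * 2 ^ card X < (\<Prod>k<l. card (F k))"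
        unfolding n(3) by (simp add: T_def D_def)
      have cn: "l * sqrt (3 * K / n) = c / sqrt n" by (simp add: c_def real_sqrt_divide)
      have "1 * sqrt (3 * K / n) \<le> l * sqrt (3 * K / n)"
        using l K by (intro mult_right_mono) auto
      then have s1: "sqrt (3 * K / n) \<le> 1" using cn c_le[OF n(1)] by linarith
      have "l * sqrt (K / n) \<le> l * sqrt (3 * K / n)"
        using K by (intro mult_left_mono real_sqrt_le_mono divide_right_mono) auto
      then have s2: "l * sqrt (K / n) \<le> 1 / 16" using cn c_le[OF n(1)] by linarith
      show "real (\<Prod>k<l. card (F k)) \<le> (1 + C / sqrt n) * T n"
      proof (cases "\<exists>x\<in>X. \<forall>k<l. point_density x (F k) \<le> 1 / 3")
        case True
        then obtain x where x: "x \<in> X" "\<And>k. k < l \<Longrightarrow> point_density x (F k) \<le> 1 / 3" by blast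
        have IH: "real (\<Prod>k<l. card (deletion x (F k))) \<le> (1 + C / sqrt n') * T n'"
          using X x(1) n(3) by (intro step.IH[of "X - {x}"] overlapping_on_deletion F) (auto simp: n_def)
        have "real (\<Prod>k<l. card (F k)) \<le> 8 / 5 * real (\<Prod>k<l. card (deletion x (F k)))"
          using l s2 n x(2) by (intro prod_card_le_deletion[OF X F m _ \<kappa> K_def[unfolded D_def] large]) auto
        also have "\<dots> \<le> 8 / 5 * ((1 + C / sqrt n') * T n')"
          by (rule mult_left_mono[OF IH]) simp
        \<comment> \<open>\<open>T\<close> at least doubles from \<open>n'\<close> to
          \<open>n\<close>, so 8/5 becomes 4/5.\<close>
        also have "\<dots> \<le> 8 / 5 * ((1 + C / sqrt n') * (T n / 2))"
          using \<kappa> C by (intro mult_left_mono) (auto simp: T_def n_def intro!: power_mono mult_nonneg_nonneg)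
        also have "\<dots> = (4 / 5 * (1 + C / sqrt n')) * T n" by simp
        also have "\<dots> \<le> (1 + C / sqrt n) * T n"
        proof (intro mult_right_mono T)
          \<comment> \<open>The gain 4/5 must outweigh the larger error term at
            \<open>n'\<close>.\<close>
          have "4 / 5 * sqrt n \<le> sqrt n'"
          proof (rule real_le_rsqrt)
            have "(4 / 5 * sqrt n) ^ 2 = 16 / 25 * n" by (simp add: power_mult_distrib power_divide)
            then show "(4 / 5 * sqrt n) ^ 2 \<le> n'" using step.hyps n0 by (simp add: n_def)
          qed
          then have "4 / 5 / sqrt n' \<le> 1 / sqrt n"
            using step.hyps n0 n(2) by (simp add: field_simps)
          then have "C * (4 / 5 / sqrt n') \<le> C * (1 / sqrt n)" using C by (rule mult_left_mono)
          moreover define y z where "y = C / sqrt n" and "z = C / sqrt n'"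
          ultimately have "4 / 5 * z \<le> y" by (simp add: mult.commute)
          then show "4 / 5 * (1 + C / sqrt n') \<le> 1 + C / sqrt n"
            unfolding y_def[symmetric] z_def[symmetric] by simp
        qed
        finally show ?thesis .
      next
        case False
        define u where "u = 1 / sqrt n"
        have u: "0 \<le> u" "u \<le> 1" using n(2) by (auto simp: u_def n_def)
        have "c * u = c / sqrt n" by (simp add: u_def)
        then have cu: "c * u \<le> 1 / 2" using c_le[OF n(1)] by linarith
        have "real (\<Prod>k<l. card (F k)) * (1 - l * sqrt (3 * K / card X)) \<le>
            \<kappa> * (card X + m * (l choose 2)) ^ (m * (l choose 2)) * 2 ^ card X"
          using False s1 n(3)
          by (intro prod_card_le_structured[OF X F m l \<kappa>_def[THEN meta_eq_to_obj_eq] K_def[unfolded D_def] large])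
            (auto simp: not_le)
        then have "real (\<Prod>k<l. card (F k)) * (1 - c * u) \<le> \<kappa> * (real n + D) ^ D * 2 ^ n"
          unfolding n(3) cn by (simp add: u_def D_def)
        also have "(real n + D) ^ D = n ^ D * (1 + D * (1 / n)) ^ D"
          using n(2) by (simp add: field_simps flip: power_mult_distrib)
        also have "\<dots> \<le> n ^ D * (1 + B * u)"
        proof (intro mult_left_mono)
          have "sqrt n \<le> n" using n(1) n0 by (intro real_le_lsqrt) (auto simp: power2_eq_square)
          then have "1 / n \<le> u" using n(2) by (simp add: u_def frac_le)
          then have "(1 + D * (1 / n)) ^ D \<le> (1 + D * u) ^ D"
            using n(2) by (intro power_mono add_left_mono mult_left_mono) auto
          also have "\<dots> \<le> 1 + B * u"
            unfolding B_def using u by (intro one_plus_power_le) auto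
          finally show "(1 + D * (1 / n)) ^ D \<le> 1 + B * u" .
        qed simp
        finally have *: "real (\<Prod>k<l. card (F k)) * (1 - c * u) \<le> T n * (1 + B * u)"
          using \<kappa> by (simp add: T_def mult_ac)
        \<comment> \<open>As \<open>c * u <= 1 / 2\<close>, the factor
          \<open>1 + 2 * (c * u)\<close> dominates the reciprocal of
          \<open>1 - c * u\<close>.\<close>
        have "1 \<le> (1 - c * u) * (1 + 2 * (c * u))"
        proof -
          have "0 \<le> (c * u) * (1 - 2 * (c * u))"
            using c u cu by (intro mult_nonneg_nonneg) auto
          then show ?thesis by (simp add: algebra_simps)
        qed
        then have "real (\<Prod>k<l. card (F k)) * 1 \<le>
            real (\<Prod>k<l. card (F k)) * ((1 - c * u) * (1 + 2 * (c * u)))"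
          by (intro mult_left_mono of_nat_0_le_iff)
        also have "\<dots> = (real (\<Prod>k<l. card (F k)) * (1 - c * u)) * (1 + 2 * (c * u))" by simp
        also have "\<dots> \<le> (T n * (1 + B * u)) * (1 + 2 * (c * u))"
          using * c u by (intro mult_right_mono) auto
        also have "\<dots> = (1 + (B + 2 * c) * u + (2 * c * B * u) * u) * T n" by (simp add: algebra_simps)
        also have "\<dots> \<le> (1 + (B + 2 * c) * u + (2 * c * B * u) * 1) * T n"
          using T u c B by (intro mult_right_mono add_left_mono mult_left_mono) auto
        also have "\<dots> = (1 + (2 * c + B + 2 * c * B) * u) * T n" by (simp add: algebra_simps)
        also have "\<dots> \<le> (1 + C * u) * T n"
          using T u unfolding C_def by (intro mult_right_mono add_left_mono) auto
        finally show ?thesis by (simp add: u_def)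
      qed
    qed
  qed
  show thesis
    by (rule that[of n\<^sub>0 C]) (use main in \<open>auto simp: T_def D_def\<close>)
qed

section \<open>The lower bound\<close>

text \<open>The right side is the product of \<open>r + 1\<close> up to
  \<open>r + m\<close>.\<close>

lemma power_le_binomial_fact: "r ^ m \<le> ((r + m) choose m) * fact m"
proof (induction m)
  case 0
  then show ?case by simp
next
  case (Suc m)
  have "r ^ Suc m \<le> Suc (r + m) * (((r + m) choose m) * fact m)"
    unfolding power_Suc using Suc by (intro mult_mono) auto
  also have "\<dots> = (Suc m * (Suc (r + m) choose Suc m)) * fact m"
    by (simp only: Suc_times_binomial mult.assoc)
  finally show ?case by (simp only: fact_Suc of_nat_id add_Suc_right mult_ac)
qed

text \<open>Intersecting the union with \<open>V p\<close> recovers the component at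
  \<open>p\<close>, so the union map is injective.\<close>

lemma card_Union_PiE:
  assumes "finite J" "\<And>p. p \<in> J \<Longrightarrow> G p \<subseteq> Pow (V p)"
    and "\<And>p q. p \<in> J \<Longrightarrow> q \<in> J \<Longrightarrow> p \<noteq> q \<Longrightarrow> V p \<inter> V q = {}"
  shows "card ((\<lambda>f. \<Union>p\<in>J. f p) ` PiE J G) = (\<Prod>p\<in>J. card (G p))"
proof -
  have "inj_on (\<lambda>f. \<Union>p\<in>J. f p) (PiE J G)"
  proof (rule inj_onI)
    fix f g assume f: "f \<in> PiE J G" and g: "g \<in> PiE J G" and eq: "(\<Union>p\<in>J. f p) = (\<Union>p\<in>J. g p)"
    have restrict: "(\<Union>q\<in>J. h q) \<inter> V p = h p" if h: "h \<in> PiE J G" and p: "p \<in> J" for h p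
    proof -
      have sub: "h q \<subseteq> V q" if "q \<in> J" for q using PiE_mem[OF h that] assms(2)[OF that] by blast
      have "h q \<inter> V p = {}" if "q \<in> J" "q \<noteq> p" for q
        using sub[OF that(1)] assms(3)[OF that(1) p that(2)] by blast
      then show ?thesis using sub[OF p] p by blast
    qed
    show "f = g"
      by (rule PiE_ext[OF f g]) (metis restrict f g eq)
  qed
  then show ?thesis using assms(1) by (simp add: card_image card_PiE)
qed

lemma card_residue_class_ge:
  assumes "r < M"
  shows "n div M \<le> card {x\<in>{1..n}. x mod M = r}"
proof -
  \<comment> \<open>One representative per full block; since \<open>{1..n}\<close> starts at 1,
    residue 0 is represented by the end of the block.\<close>
  define g where "g j = (if r = 0 then (j + 1) * M else j * M + r)" for j
  have "g ` {..<n div M} \<subseteq> {x\<in>{1..n}. x mod M = r}"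
  proof (rule image_subsetI)
    fix j assume "j \<in> {..<n div M}"
    then have "(j + 1) * M \<le> (n div M) * M" by (intro mult_right_mono) auto
    also have "\<dots> \<le> n" by simp
    finally have "(j + 1) * M \<le> n" .
    then show "g j \<in> {x\<in>{1..n}. x mod M = r}" using assms by (auto simp: g_def)
  qed
  moreover have "inj_on g {..<n div M}"
    using assms by (auto simp: inj_on_def g_def)
  ultimately have "card {..<n div M} \<le> card {x\<in>{1..n}. x mod M = r}"
    by (intro card_inj_on_le) auto
  then show ?thesis by simp
qed

text \<open>Construction matching \<open>prod_card_le_partitioned\<close>. Every part is used by
  exactly two families, one free and one small on it, and the free choices over all parts multiply
  to \<open>2 ^ card X\<close>.\<close>

lemma ex_overlapping_on_partitioned:
  assumes X: "finite X" and e: "\<And>x. x \<in> X \<Longrightarrow> e x \<in> ordered_pairs {..<l}"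
  obtains F where "overlapping_on X l m F"
    "2 ^ card X * (\<Prod>p\<in>ordered_pairs {..<l}. card (small_subsets {x\<in>X. e x = p} m)) \<le> (\<Prod>k<l. card (F k))"
proof -
  define E where "E = ordered_pairs {..<l}"
  define V where "V p = {x\<in>X. e x = p}" for p
  define J where "J k = {p\<in>E. k = fst p \<or> k = snd p}" for k
  \<comment> \<open>On the part of \<open>p = (i, k)\<close> the family \<open>i\<close> is unrestricted and the family \<open>k\<close> has at most
    \<open>m\<close> elements; all other families avoid the part.\<close>
  define G where "G k p = (if k = snd p then small_subsets (V p) m else Pow (V p))" for k p
  define F where "F k = (\<lambda>f. \<Union>p\<in>J k. f p) ` PiE (J k) (G k)" for k
  have E: "finite E" by (simp add: E_def finite_ordered_pairs)
  have GV: "G k p \<subseteq> Pow (V p)" for k p by (auto simp: G_def small_subsets_def)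
  have VV: "V p \<inter> V q = {}" if "p \<noteq> q" for p q using that by (auto simp: V_def)
  have "overlapping_on X l m F"
    unfolding overlapping_on_def
  proof (intro conjI allI impI ballI)
    fix k assume "k < l"
    show "F k \<subseteq> Pow X"
    proof
      fix A assume "A \<in> F k"
      then obtain f where f: "f \<in> PiE (J k) (G k)" "A = (\<Union>p\<in>J k. f p)" by (auto simp: F_def)
      have "f p \<subseteq> X" if "p \<in> J k" for p
        using PiE_mem[OF f(1) that] GV[of k p] by (auto simp: V_def)
      then show "A \<in> Pow X" using f(2) by blast
    qed
  next
    fix i k A B assume ik: "i < k" "k < l" and A: "A \<in> F i" and B: "B \<in> F k"
    from A obtain f where f: "f \<in> PiE (J i) (G i)" "A = (\<Union>p\<in>J i. f p)" by (auto simp: F_def)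
    from B obtain g where g: "g \<in> PiE (J k) (G k)" "B = (\<Union>p\<in>J k. g p)" by (auto simp: F_def)
    have p: "(i, k) \<in> J k" using ik by (auto simp: J_def E_def ordered_pairs_def)
    \<comment> \<open>A common point lies in one part, whose pair must involve both \<open>i\<close>
      and \<open>k\<close>; on that part the family \<open>k\<close> is the small one.\<close>
    have "A \<inter> B \<subseteq> g (i, k)"
    proof
      fix x assume x: "x \<in> A \<inter> B"
      then obtain p q where p: "p \<in> J i" "x \<in> f p" and q: "q \<in> J k" "x \<in> g q"
        using f(2) g(2) by blast
      have "x \<in> V p" using PiE_mem[OF f(1) p(1)] GV p(2) by blast
      moreover have "x \<in> V q" using PiE_mem[OF g(1) q(1)] GV q(2) by blast
      ultimately have "p = q" using VV by blast
      then have "q = (i, k)"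
        using p(1) q(1) ik(1) by (cases q) (auto simp: J_def E_def ordered_pairs_def)
      then show "x \<in> g (i, k)" using q(2) by simp
    qed
    moreover have "g (i, k) \<in> small_subsets (V (i, k)) m"
      using PiE_mem[OF g(1) p] by (simp add: G_def)
    ultimately show "card (A \<inter> B) \<le> m"
      using X card_mono[of "g (i, k)" "A \<inter> B"] finite_subset[of "g (i, k)" "V (i, k)"]
      by (auto simp: small_subsets_def V_def)
  qed
  moreover have "2 ^ card X * (\<Prod>p\<in>E. card (small_subsets (V p) m)) = (\<Prod>k<l. card (F k))"
  proof -
    have "(\<Prod>k<l. card (F k)) = (\<Prod>k<l. \<Prod>p\<in>J k. card (G k p))"
      unfolding F_def using E GV VV by (intro prod.cong card_Union_PiE[where V = V]) (auto simp: J_def)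
    \<comment> \<open>Regrouping by pairs instead of families, so that each pair has just its two
      factors.\<close>
    also have "\<dots> = (\<Prod>p\<in>E. \<Prod>k\<in>{k\<in>{..<l}. k = fst p \<or> k = snd p}. card (G k p))"
      unfolding J_def by (rule prod.swap_restrict[OF finite_lessThan E])
    also have "\<dots> = (\<Prod>p\<in>E. 2 ^ card (V p) * card (small_subsets (V p) m))"
    proof (rule prod.cong)
      fix p assume "p \<in> E"
      then have "{k\<in>{..<l}. k = fst p \<or> k = snd p} = {fst p, snd p}" "fst p \<noteq> snd p"
        by (auto simp: E_def ordered_pairs_def)
      then show "(\<Prod>k\<in>{k\<in>{..<l}. k = fst p \<or> k = snd p}. card (G k p)) =
          2 ^ card (V p) * card (small_subsets (V p) m)"
        using X by (simp add: G_def V_def card_Pow)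
    qed simp
    also have "\<dots> = 2 ^ (\<Sum>p\<in>E. card (V p)) * (\<Prod>p\<in>E. card (small_subsets (V p) m))"
      by (simp add: prod.distrib power_sum)
    also have "(\<Sum>p\<in>E. card (V p)) = card (\<Union>p\<in>E. V p)"
      using X E VV by (intro card_UN_disjoint[symmetric]) (auto simp: V_def)
    also have "(\<Union>p\<in>E. V p) = X" using e by (auto simp: V_def E_def)
    finally show ?thesis by simp
  qed
  ultimately show thesis using that[of F] by (simp add: E_def V_def)
qed

text \<open>Residues modulo \<open>l choose 2\<close> give nearly equal parts. The relative error is
  of order \<open>1 / n\<close>, smaller than the theorem asks for.\<close>

theorem prod_card_lower_bound:
  fixes l m n :: nat
  assumes l: "l \<ge> 2" and n: "n \<ge> (l choose 2) * (m + 1)"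
  defines "\<kappa> \<equiv> (1 / (fact m * real (l choose 2) ^ m)) ^ (l choose 2)"
  obtains F where "overlapping_on {1..n} l m F"
    "(1 - real (m * (l choose 2) * ((l choose 2) * (m + 1))) / n) * (\<kappa> * n ^ (m * (l choose 2)) * 2 ^ n) \<le>
      real (\<Prod>k<l. card (F k))"
proof -
  define E M where "E = ordered_pairs {..<l}" and "M = l choose 2"
  have E: "finite E" "card E = M" by (simp_all add: E_def M_def finite_ordered_pairs card_ordered_pairs)
  have M: "M > 0" using l by (simp add: M_def)
  have "0 < M * (m + 1)" using M by simp
  then have n0: "n > 0" using n unfolding M_def by linarith
  obtain h where h: "bij_betw h {0..<M} E" using ex_bij_betw_nat_finite[OF E(1)] E(2) by blast
  define e where "e x = h (x mod M)" for x
  have e: "e x \<in> E" for x using bij_betw_apply[OF h, of "x mod M"] M by (simp add: e_def)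
  obtain F where F: "overlapping_on {1..n} l m F"
    and prod_F: "2 ^ card {1..n} * (\<Prod>p\<in>E. card (small_subsets {x\<in>{1..n}. e x = p} m)) \<le> (\<Prod>k<l. card (F k))"
    using ex_overlapping_on_partitioned[of "{1..n}" e l m] e by (auto simp: E_def)
  \<comment> \<open>The shift by \<open>m\<close> fits \<open>power_le_binomial_fact\<close>; the
    hypothesis on \<open>n\<close> prevents truncation.\<close>
  define r where "r = n div M - m"
  have "m + 1 \<le> n div M"
    using n M by (simp add: M_def less_eq_div_iff_mult_less_eq mult.commute)
  then have q: "n div M = r + m" by (simp add: r_def)
  have small: "real r ^ m / fact m \<le> real (card (small_subsets {x\<in>{1..n}. e x = p} m))" if p: "p \<in> E" for p
  proof -
    define V where "V = {x\<in>{1..n}. e x = p}"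
    obtain s where s: "s < M" "p = h s" using p h by (auto simp: bij_betw_def)
    have "e x = p \<longleftrightarrow> x mod M = s" for x
      unfolding e_def s(2) using h s(1) M by (intro inj_on_eq_iff[of h "{0..<M}"]) (auto simp: bij_betw_def)
    then have "V = {x\<in>{1..n}. x mod M = s}" by (simp add: V_def)
    then have "r + m \<le> card V" using card_residue_class_ge[OF s(1), of n] q by simp
    then have "r ^ m \<le> (card V choose m) * fact m"
      by (intro order_trans[OF power_le_binomial_fact] mult_right_mono binomial_right_mono) auto
    also have "\<dots> \<le> card (small_subsets V m) * fact m"
    proof (rule mult_right_mono)
      show "card V choose m \<le> card (small_subsets V m)"
        by (subst card_small_subsets) (auto simp: V_def intro!: member_le_sum)
    qed simp
    finally have "real (r ^ m) \<le> real (card (small_subsets V m) * fact m)" by (simp only: of_nat_le_iff)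
    then show ?thesis by (simp add: V_def field_simps)
  qed
  \<comment> \<open>Chosen so that \<open>n / M * (1 - w) = n / M - (m + 1)\<close>, a lower bound
    for \<open>r\<close>: rounding loses at most 1 and the shift loses \<open>m\<close>.\<close>
  define w where "w = real (M * (m + 1)) / n"
  have w: "w \<le> 1" using n n0 by (simp add: w_def M_def field_simps flip: of_nat_mult of_nat_add)
  have "(1 - real (m * M) * w) \<le> (1 - w) ^ (m * M)"
    using Bernoulli_inequality[of "- w" "m * M"] w by simp
  then have "(1 - real (m * M) * w) * (\<kappa> * n ^ (m * M) * 2 ^ n) \<le>
      (1 - w) ^ (m * M) * (\<kappa> * n ^ (m * M) * 2 ^ n)"
    by (intro mult_right_mono) (auto simp: \<kappa>_def)
  also have "\<dots> = ((n / M * (1 - w)) ^ m / fact m) ^ M * 2 ^ n"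
    by (simp add: \<kappa>_def M_def power_divide power_mult_distrib mult_ac flip: power_mult)
  also have "\<dots> \<le> (real r ^ m / fact m) ^ M * 2 ^ n"
  proof (intro mult_right_mono power_mono divide_right_mono)
    have "n < M * (n div M + 1)" using M by (metis add.commute dividend_less_times_div mult_Suc_right plus_1_eq_Suc)
    then have "n \<le> M * (r + m + 1)" using q by simp
    then have "real n \<le> real (M * (r + m + 1))" by (simp only: of_nat_le_iff)
    then have "n / M \<le> real r + (m + 1)" using M by (simp add: field_simps)
    moreover have "n / M * (1 - w) = n / M - (m + 1)" using M n0 by (simp add: w_def field_simps)
    ultimately show "n / M * (1 - w) \<le> real r" by linarith
  qed (use w in auto)
  also have "\<dots> = (\<Prod>p\<in>E. real r ^ m / fact m) * 2 ^ n" using E by simp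
  also have "\<dots> \<le> (\<Prod>p\<in>E. real (card (small_subsets {x\<in>{1..n}. e x = p} m))) * 2 ^ n"
    by (intro mult_right_mono prod_mono conjI small) auto
  also have "\<dots> = real (2 ^ card {1..n} * (\<Prod>p\<in>E. card (small_subsets {x\<in>{1..n}. e x = p} m)))" by simp
  also have "\<dots> \<le> real (\<Prod>k<l. card (F k))" using prod_F by (simp only: of_nat_le_iff)
  finally show thesis using that[OF F] by (simp add: w_def M_def)
qed

section \<open>The asymptotic formula\<close>

lemma s_star_attained:
  obtains F where "overlapping_on {1..n} l m F" "s_star n l m = (\<Prod>k<l. card (F k))"
proof -
  have "s_star n l m \<in> products n l m"
    unfolding s_star_def by (rule Max_in[OF finite_products products_nonempty])
  then obtain F where F: "F \<in> {1..l} \<rightarrow> Pow (Pow {1..n})" "overlapping m l F"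
    and eq: "s_star n l m = (\<Prod>k=1..l. card (F k))"
    unfolding products_def by auto
  have "overlapping_on {1..n} l m (\<lambda>k. F (Suc k))"
    unfolding overlapping_on_def
  proof (intro conjI allI impI ballI)
    show "F (Suc k) \<subseteq> Pow {1..n}" if "k < l" for k
      using funcset_mem[OF F(1), of "Suc k"] that by simp
    show "card (A \<inter> B) \<le> m" if "i < k" "k < l" "A \<in> F (Suc i)" "B \<in> F (Suc k)" for i k A B
    proof -
      have "Suc i \<in> {1..l}" "Suc k \<in> {1..l}" "Suc i \<noteq> Suc k" using that by auto
      then show ?thesis using F(2) that unfolding overlapping_def by blast
    qed
  qed
  moreover have "s_star n l m = (\<Prod>k<l. card (F (Suc k)))"
    unfolding eq by (simp add: prod.atLeast1_atMost_eq)
  ultimately show thesis by (rule that)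
qed

lemma prod_card_le_s_star:
  assumes "overlapping_on {1..n} l m F"
  shows "(\<Prod>k<l. card (F k)) \<le> s_star n l m"
proof -
  define G where "G k = F (k - 1)" for k
  have "G \<in> {1..l} \<rightarrow> Pow (Pow {1..n})"
  proof
    fix k assume "k \<in> {1..l}"
    then have "k - 1 < l" by auto
    then show "G k \<in> Pow (Pow {1..n})"
      using overlapping_onD(1)[OF assms] by (simp add: G_def)
  qed
  moreover have "overlapping m l G"
    unfolding overlapping_def
  proof (intro ballI impI)
    fix i k A B assume "i \<in> {1..l}" "k \<in> {1..l}" "i \<noteq> k" "A \<in> G i" "B \<in> G k"
    \<comment> \<open>\<open>overlapping\<close> speaks of distinct indices in either order,
      \<open>overlapping_on\<close> only of increasing ones.\<close>
    then have "i - 1 < k - 1 \<and> k - 1 < l \<or> k - 1 < i - 1 \<and> i - 1 < l" by auto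
    then show "card (A \<inter> B) \<le> m"
      using overlapping_onD(2)[OF assms, of "i - 1" "k - 1" A B]
        overlapping_onD(2)[OF assms, of "k - 1" "i - 1" B A] \<open>A \<in> G i\<close> \<open>B \<in> G k\<close>
      by (auto simp: G_def Int_commute)
  qed
  moreover have "(\<Prod>k=1..l. card (G k)) = (\<Prod>k<l. card (F k))"
    by (simp add: prod.atLeast1_atMost_eq G_def)
  ultimately have "(\<Prod>k<l. card (F k)) \<in> products n l m"
    unfolding products_def by (auto intro!: exI[of _ G])
  then show ?thesis unfolding s_star_def by (rule Max_ge[OF finite_products])
qed

theorem corollary3:
  fixes l m :: nat
  assumes "l \<ge> 2"
  shows "\<exists>\<epsilon> :: nat \<Rightarrow> real. \<epsilon> \<in> O(\<lambda>n. 1 / sqrt (real n)) \<and>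
    (\<forall>\<^sub>F n in at_top. real (s_star n l m) =
       (1 + \<epsilon> n) * (1 / fact m * (real n / real (l choose 2)) ^ m) ^ (l choose 2) * 2 ^ n)"
proof -
  define M where "M = l choose 2"
  define \<kappa> where "\<kappa> = (1 / (fact m * real M ^ m)) ^ M"
  define T where "T n = \<kappa> * real n ^ (m * M) * 2 ^ n" for n :: nat
  \<comment> \<open>The exact relative error: the identity then holds for all \<open>n >= 1\<close>,
    and only the size of \<open>\<epsilon>\<close> is at stake.\<close>
  define \<epsilon> where "\<epsilon> n = real (s_star n l m) / T n - 1" for n
  have M: "M > 0" using assms by (simp add: M_def)
  have T: "T n > 0" if "n > 0" for n using that M by (simp add: T_def \<kappa>_def)
  have T_eq: "(1 / fact m * (real n / real M) ^ m) ^ M * 2 ^ n = T n" for n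
    by (simp add: T_def \<kappa>_def power_divide power_mult_distrib flip: power_mult)
  obtain C :: real and n\<^sub>0 :: nat where upper: "\<And>(X :: nat set) F. finite X \<Longrightarrow> n\<^sub>0 \<le> card X \<Longrightarrow> overlapping_on X l m F \<Longrightarrow>
      real (\<Prod>k<l. card (F k)) \<le> (1 + C / sqrt (card X)) * T (card X)"
    by (rule prod_card_upper_bound[OF assms, of m]) (rule that, unfold T_def \<kappa>_def M_def)
  define C' where "C' = real (m * M * (M * (m + 1)))"
  have "\<bar>\<epsilon> n\<bar> \<le> max C C' * (1 / sqrt n)" if n: "n \<ge> max (max 1 n\<^sub>0) (M * (m + 1))" for n
  proof -
    have n0: "n \<ge> 1" using n by simp
    obtain F where "overlapping_on {1..n} l m F" "s_star n l m = (\<Prod>k<l. card (F k))"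
      by (rule s_star_attained)
    then have "real (s_star n l m) \<le> (1 + C / sqrt n) * T n"
      using upper[of "{1..n}" F] n by simp
    then have "\<epsilon> n \<le> C * (1 / sqrt n)" using T[of n] n0 by (simp add: \<epsilon>_def field_simps)
    also have "\<dots> \<le> max C C' * (1 / sqrt n)" by (intro mult_right_mono) auto
    finally have le: "\<epsilon> n \<le> max C C' * (1 / sqrt n)" .
    obtain G where G: "overlapping_on {1..n} l m G"
      and "(1 - C' / n) * T n \<le> real (\<Prod>k<l. card (G k))"
      using prod_card_lower_bound[OF assms, of m n] n unfolding T_def \<kappa>_def M_def C'_def by auto
    moreover have "real (\<Prod>k<l. card (G k)) \<le> real (s_star n l m)"
      using prod_card_le_s_star[OF G] by (simp only: of_nat_le_iff)
    ultimately have "(1 - C' / n) * T n \<le> real (s_star n l m)" by linarith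
    then have "- (C' * (1 / n)) \<le> \<epsilon> n" using T[of n] n0 by (simp add: \<epsilon>_def field_simps)
    \<comment> \<open>The lower error \<open>1 / n\<close> is weakened to \<open>1 / sqrt n\<close>;
      \<open>C' >= 0\<close> makes the maximum nonnegative.\<close>
    moreover have "C' * (1 / n) \<le> max C C' * (1 / sqrt n)"
    proof (rule mult_mono)
      have "sqrt n \<le> n" using n0 by (intro real_le_lsqrt) (auto simp: power2_eq_square)
      then show "1 / real n \<le> 1 / sqrt n" using n0 by (simp add: frac_le)
    qed (auto simp: C'_def le_max_iff_disj)
    ultimately show ?thesis using le by linarith
  qed
  then have "\<epsilon> \<in> O(\<lambda>n. 1 / sqrt (real n))"
    by (intro bigoI[of _ "max C C'"] eventually_at_top_linorderI[of "max (max 1 n\<^sub>0) (M * (m + 1))"]) auto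
  moreover have "\<forall>\<^sub>F n in at_top. real (s_star n l m) =
      (1 + \<epsilon> n) * (1 / fact m * (real n / real M) ^ m) ^ M * 2 ^ n"
  proof (rule eventually_at_top_linorderI[of 1])
    fix n :: nat assume "n \<ge> 1"
    then have "real (s_star n l m) = (1 + \<epsilon> n) * T n" using T[of n] by (simp add: \<epsilon>_def)
    then show "real (s_star n l m) = (1 + \<epsilon> n) * (1 / fact m * (real n / real M) ^ m) ^ M * 2 ^ n"
      by (simp only: T_eq[symmetric] mult.assoc)
  qed
  ultimately show ?thesis unfolding M_def by blast
qed

end
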